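(* Let $\mathcal R$ be any encoding system and $\mathcal C$ any complexity measure satisfying Assumption (E) of the context. Then the Language Equivalence Problem for $\mathcal R$ is decidable if and only if the length complexity $N(\mathcal F^{\mathcal R}_c)$ is computably bounded in $c$. Thus decidability of the Language Equivalence Problem for $\mathcal R$ is also equivalent to the property that $\mathcal F^{\mathcal R}$ admits non-asymptotic length generalization (w.r.t. $\mathcal R$ and $\mathcal C$).
   Context: Strings are over $\{0,1\}$; $\{0,1\}^*$ contains the empty string. Encoding system: a Turing machine $\mathcal R$ which, on input any string $p\in\{0,1\}^*$, outputs the description of a Turing machine computing a total function $\{0,1\}^*\to\{0,1\}$; this function is denoted $\mathcal R(p)$. Put $\mathcal F^{\mathcal R}=\{\mathcal R(p):p\in\{0,1\}^*\}$. Language Equivalence Problem for $\mathcal R$: given any $p,q\in\{0,1\}^*$, determine whether $\mathcal R(p)=\mathcal R(q)$ (as functions). Complexity measure: a map $\mathcal C:\{0,1\}^*\to\mathbb N$. For $f\in\mathcal F^{\mathcal R}$, $\mathcal C^{\mathcal R}(f)=\min\{\mathcal C(p):\mathcal R(p)=f\}$, and $\mathcal F^{\mathcal R}_c=\{f\in\mathcal F^{\mathcal R}:\mathcal C^{\mathcal R}(f)\le c\}$. Assumption (E): $\mathcal C$ is computable; there is a Turing machine $E$ enumerating all of $\{0,1\}^*$ in non-decreasing order of $\mathcal C$ (range of $E$ is $\{0,1\}^*$, and $i\le i'$ implies $\mathcal C(E(i))\le\mathcal C(E(i'))$); and for each $c\in\mathbb N$ the set $\{p:\mathcal C(p)\le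 c\}$ is finite. Length complexity of a class $\mathcal F$: $N(\mathcal F)=\min\{n\in\mathbb N:\forall f\ne f'\in\mathcal F,\ \exists x\in\{0,1\}^*,|x|\le n,\ f(x)\ne f'(x)\}$. A function $g:\mathbb N\to\mathbb N$ is computably bounded if there is a total computable $h:\mathbb N\to\mathbb N$ with $g(n)\le h(n)$ for all $n$. Training data: $D_N(f)=\{(x,f(x)):x\in\{0,1\}^*,|x|\le N\}$. A learning algorithm is a Turing machine $\mathcal A$ that takes a training set $D_N(f)$ and outputs a string. $\mathcal F^{\mathcal R}$ admits non-asymptotic length generalization w.r.t. $\mathcal R,\mathcal C$ if there exist a learning algorithm $\mathcal A$ and a computable $\hat N:\mathbb N\to\mathbb N$ such that for all $f\in\mathcal F^{\mathcal R}$ and all $N'\ge\hat N(\mathcal C^{\mathcal R}(f))$, $\mathcal R(\mathcal A(D_{N'}(f)))=f$. *)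

theory Defs
  imports Main
begin

text \<open>
  Strings over \<open>{0,1}\<close> are lists of booleans, with 0 and 1 read as \<^const>\<open>False\<close> and \<^const>\<open>True\<close>;
  a function from strings to \<open>{0,1}\<close> is a predicate on strings.
\<close>

type_synonym word = "bool list"


subsection \<open>Turing machines\<close>

text \<open>
  Deterministic machines with \<open>k \<ge> 1\<close> two-way infinite tapes over the alphabet \<open>{blank, 0, 1}\<close>.
  The blank is \<^const>\<open>None\<close>.  A tape is indexed relative to its head: cell \<open>0\<close> is the scanned cell,
  and a head move shifts the indexing.
\<close>

type_synonym sym = "bool option"
type_synonym tape = "int \<Rightarrow> sym"

datatype move = Go_Left | Stay | Go_Right

text \<open>
  A rule \<open>((q, ss), (q', as))\<close> reads: in state \<open>q\<close>, scanning the symbols \<open>ss\<close> on the tapes, enter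
  state \<open>q'\<close> and perform on each tape the corresponding action (write a symbol, then move).
\<close>

type_synonym rule = "(nat \<times> sym list) \<times> (nat \<times> (sym \<times> move) list)"

datatype tm = TM (tapes: nat) (rules: "rule list")

definition well_formed :: "tm \<Rightarrow> bool" where
  "well_formed M \<longleftrightarrow> tapes M \<ge> 1 \<and>
     (\<forall>((q, ss), (q', as)) \<in> set (rules M). length ss = tapes M \<and> length as = tapes M)"

fun act :: "sym \<times> move \<Rightarrow> tape \<Rightarrow> tape" where
  "act (s, Stay) t = t(0 := s)"
| "act (s, Go_Left) t = (\<lambda>i. (t(0 := s)) (i - 1))"
| "act (s, Go_Right) t = (\<lambda>i. (t(0 := s)) (i + 1))"

type_synonym config = "nat \<times> tape list"

text \<open>
  The first applicable rule is used, so every rule list denotes a partial transition function.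
  The machine halts when no rule applies.
\<close>

fun step :: "tm \<Rightarrow> config \<Rightarrow> config option" where
  "step M (q, ts) =
     (case map_of (rules M) (q, map (\<lambda>t. t 0) ts) of
        None \<Rightarrow> None
      | Some (q', as) \<Rightarrow> Some (q', map2 act as ts))"

definition tape_of :: "word \<Rightarrow> tape" where
  "tape_of w = (\<lambda>i. if 0 \<le> i \<and> i < int (length w) then Some (w ! nat i) else None)"

definition initial :: "tm \<Rightarrow> word \<Rightarrow> config" where
  "initial M w = (0, tape_of w # replicate (tapes M - 1) (tape_of []))"

definition shows_word :: "tape \<Rightarrow> word \<Rightarrow> bool" where
  "shows_word t w \<longleftrightarrow> (\<forall>i < length w. t (int i) = Some (w ! i)) \<and> t (int (length w)) = None"

text \<open>
  \<open>yields M x y\<close>: on input \<open>x\<close> (on the first tape) the machine halts with output \<open>y\<close>, the string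
  on the first tape from the head up to, but excluding, the first blank.
\<close>

definition yields :: "tm \<Rightarrow> word \<Rightarrow> word \<Rightarrow> bool" where
  "yields M x y \<longleftrightarrow>
     (\<exists>q ts. (\<lambda>c c'. step M c = Some c')\<^sup>*\<^sup>* (initial M x) (q, ts) \<and>
             step M (q, ts) = None \<and> shows_word (hd ts) y)"

lemma shows_word_unique:
  assumes "shows_word t v" "shows_word t w"
  shows "v = w"
proof -
  have "\<not> length v < length w" "\<not> length w < length v"
    using assms unfolding shows_word_def by force+
  then have "length v = length w" by simp
  then show ?thesis
    using assms unfolding shows_word_def by (metis nth_equalityI option.inject)
qed

lemma yields_unique:
  assumes "yields M x y" "yields M x z"
  shows "y = z"
proof -
  let ?S = "\<lambda>c c'. step M c = Some c'"
  have det: "d = e" if "?S\<^sup>*\<^sup>* c d" "step M d = None" "?S\<^sup>*\<^sup>* c e" "step M e = None" for c d e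
    using that
  proof (induction rule: converse_rtranclp_induct)
    case base
    from base(2) show ?case
      by (cases rule: converse_rtranclpE) (use base(1) in auto)
  next
    case (step a b)
    from step(5) have "?S\<^sup>*\<^sup>* b e"
      by (cases rule: converse_rtranclpE) (use step(1,6) in auto)
    then show ?case by (rule step.IH[OF step(4) _ step(6)])
  qed
  obtain c where c: "?S\<^sup>*\<^sup>* (initial M x) c" "step M c = None" "shows_word (hd (snd c)) y"
    using assms(1) unfolding yields_def by (metis snd_conv)
  obtain d where d: "?S\<^sup>*\<^sup>* (initial M x) d" "step M d = None" "shows_word (hd (snd d)) z"
    using assms(2) unfolding yields_def by (metis snd_conv)
  have "c = d" by (rule det[OF c(1,2) d(1,2)])
  then show ?thesis using c(3) d(3) shows_word_unique by blast
qed


subsection \<open>Encodings as binary strings\<close>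

definition code_nat :: "nat \<Rightarrow> word" where
  "code_nat n = replicate n True @ [False]"

definition code_list :: "('a \<Rightarrow> word) \<Rightarrow> 'a list \<Rightarrow> word" where
  "code_list e xs = concat (map (\<lambda>x. True # e x) xs) @ [False]"

definition code_word :: "word \<Rightarrow> word" where
  "code_word = code_list (\<lambda>b. [b])"

definition code_pair :: "('a \<Rightarrow> word) \<Rightarrow> ('b \<Rightarrow> word) \<Rightarrow> 'a \<times> 'b \<Rightarrow> word" where
  "code_pair d e = (\<lambda>(x, y). d x @ e y)"

fun code_sym :: "sym \<Rightarrow> word" where
  "code_sym None = [False]"
| "code_sym (Some b) = [True, b]"

fun code_move :: "move \<Rightarrow> word" where
  "code_move Stay = [False]"
| "code_move Go_Left = [True, False]"
| "code_move Go_Right = [True, True]"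

definition code_rule :: "rule \<Rightarrow> word" where
  "code_rule = code_pair (code_pair code_nat (code_list code_sym))
                 (code_pair code_nat (code_list (code_pair code_sym code_move)))"

definition description :: "tm \<Rightarrow> word" where
  "description M = code_nat (tapes M) @ code_list code_rule (rules M)"

text \<open>All these encodings are prefix-free, hence concatenations of codes can be parsed uniquely.\<close>

definition prefix_code :: "('a \<Rightarrow> word) \<Rightarrow> bool" where
  "prefix_code e \<longleftrightarrow> (\<forall>x y u v. e x @ u = e y @ v \<longrightarrow> x = y \<and> u = v)"

lemma prefix_code_nat: "prefix_code code_nat"
proof -
  have "code_nat m @ u = code_nat n @ v \<Longrightarrow> m = n \<and> u = v" for m n u v
  proof (induction m arbitrary: n)
    case 0
    then show ?case by (cases n) (auto simp: code_nat_def)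
  next
    case (Suc m)
    then show ?case by (cases n) (auto simp: code_nat_def)
  qed
  then show ?thesis unfolding prefix_code_def by blast
qed

lemma prefix_code_list:
  assumes "prefix_code e"
  shows "prefix_code (code_list e)"
proof -
  have "code_list e xs @ u = code_list e ys @ v \<Longrightarrow> xs = ys \<and> u = v" for xs ys u v
  proof (induction xs arbitrary: ys)
    case Nil
    then show ?case by (cases ys) (auto simp: code_list_def)
  next
    case (Cons x xs)
    then obtain y ys' where ys: "ys = y # ys'"
      by (cases ys) (auto simp: code_list_def)
    with Cons.prems have "e x @ (code_list e xs @ u) = e y @ (code_list e ys' @ v)"
      by (simp add: code_list_def)
    with assms have "x = y" "code_list e xs @ u = code_list e ys' @ v"
      unfolding prefix_code_def by blast+
    with Cons.IH ys show ?case by blast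
  qed
  then show ?thesis unfolding prefix_code_def by blast
qed

lemma prefix_code_word: "prefix_code code_word"
  unfolding code_word_def by (rule prefix_code_list) (simp add: prefix_code_def)

lemma prefix_code_pair: "prefix_code d \<Longrightarrow> prefix_code e \<Longrightarrow> prefix_code (code_pair d e)"
proof -
  assume d: "prefix_code d" and e: "prefix_code e"
  have "x = y \<and> u = v" if eq: "code_pair d e x @ u = code_pair d e y @ v" for x y u v
  proof -
    have "d (fst x) @ (e (snd x) @ u) = d (fst y) @ (e (snd y) @ v)"
      using eq by (simp add: code_pair_def split_beta)
    then have "fst x = fst y" "e (snd x) @ u = e (snd y) @ v"
      using d unfolding prefix_code_def by blast+
    moreover from this(2) have "snd x = snd y" "u = v"
      using e unfolding prefix_code_def by blast+
    ultimately show ?thesis by (simp add: prod_eq_iff)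
  qed
  then show ?thesis unfolding prefix_code_def by blast
qed

lemma prefix_code_sym: "prefix_code code_sym"
proof -
  have "code_sym x @ u = code_sym y @ v \<Longrightarrow> x = y \<and> u = v" for x y u v
    by (cases x; cases y) auto
  then show ?thesis unfolding prefix_code_def by blast
qed

lemma prefix_code_move: "prefix_code code_move"
proof -
  have "code_move x @ u = code_move y @ v \<Longrightarrow> x = y \<and> u = v" for x y u v
    by (cases x; cases y) auto
  then show ?thesis unfolding prefix_code_def by blast
qed

lemma prefix_code_rule: "prefix_code code_rule"
  unfolding code_rule_def
  by (intro prefix_code_pair prefix_code_nat prefix_code_list prefix_code_sym prefix_code_move)

lemma description_inj: "inj description"
proof (rule injI)
  fix M M' assume "description M = description M'"
  then have "tapes M = tapes M' \<and> code_list code_rule (rules M) = code_list code_rule (rules M')"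
    using prefix_code_nat unfolding description_def prefix_code_def by blast
  moreover from this have "rules M = rules M'"
    using prefix_code_list[OF prefix_code_rule] unfolding prefix_code_def by blast
  ultimately show "M = M'" by (simp add: tm.expand)
qed


subsection \<open>Computable functions\<close>

text \<open>Total computability of \<open>f\<close>, with arguments and values encoded by \<open>d\<close> and \<open>e\<close>.\<close>

definition computable :: "('a \<Rightarrow> word) \<Rightarrow> ('b \<Rightarrow> word) \<Rightarrow> ('a \<Rightarrow> 'b) \<Rightarrow> bool" where
  "computable d e f \<longleftrightarrow> (\<exists>M. well_formed M \<and> (\<forall>x. yields M (d x) (e (f x))))"

definition computably_bounded :: "(nat \<Rightarrow> nat) \<Rightarrow> bool" where
  "computably_bounded g \<longleftrightarrow> (\<exists>h. computable code_nat code_nat h \<and> (\<forall>n. g n \<le> h n))"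


subsection \<open>Encoding systems and complexity measures\<close>

definition encoding_system :: "tm \<Rightarrow> bool" where
  "encoding_system R \<longleftrightarrow> well_formed R \<and>
     (\<forall>p. \<exists>M. well_formed M \<and> yields R p (description M) \<and> (\<forall>x. \<exists>b. yields M x [b]))"

text \<open>
  \<open>denotation R p\<close> is the function \<open>R(p)\<close> computed by the machine whose description \<open>R\<close> outputs
  on \<open>p\<close>; by the next lemma it is determined by this machine.
\<close>

definition denotation :: "tm \<Rightarrow> word \<Rightarrow> (word \<Rightarrow> bool)" where
  "denotation R p = (\<lambda>x. \<exists>M. yields R p (description M) \<and> yields M x [True])"

lemma denotation_iff:
  assumes "yields R p (description M)" "\<forall>x. \<exists>b. yields M x [b]"
  shows "yields M x [b] \<longleftrightarrow> denotation R p x = b"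
proof -
  have "M' = M" if "yields R p (description M')" for M'
    using yields_unique[OF that assms(1)] description_inj by (simp add: inj_def)
  then have "denotation R p x \<longleftrightarrow> yields M x [True]"
    using assms(1) unfolding denotation_def by blast
  then show ?thesis
    using assms(2) yields_unique by (metis (full_types) list.inject)
qed

definition representable :: "tm \<Rightarrow> (word \<Rightarrow> bool) set" where
  "representable R = range (denotation R)"

definition equivalence_decidable :: "tm \<Rightarrow> bool" where
  "equivalence_decidable R \<longleftrightarrow>
     computable (code_pair code_word code_word) (\<lambda>b. [b])
       (\<lambda>(p, q). denotation R p = denotation R q)"

definition complexity :: "tm \<Rightarrow> (word \<Rightarrow> nat) \<Rightarrow> (word \<Rightarrow> bool) \<Rightarrow> nat" where
  "complexity R C f = (LEAST c. \<exists>p. denotation R p = f \<and> C p = c)"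

definition representable_upto :: "tm \<Rightarrow> (word \<Rightarrow> nat) \<Rightarrow> nat \<Rightarrow> (word \<Rightarrow> bool) set" where
  "representable_upto R C c = {f \<in> representable R. complexity R C f \<le> c}"

definition assumption_E :: "(word \<Rightarrow> nat) \<Rightarrow> bool" where
  "assumption_E C \<longleftrightarrow>
     computable (\<lambda>p. p) code_nat C \<and>
     (\<exists>E. computable code_nat (\<lambda>p. p) E \<and> range E = UNIV \<and>
          (\<forall>i i'. i \<le> i' \<longrightarrow> C (E i) \<le> C (E i'))) \<and>
     (\<forall>c. finite {p. C p \<le> c})"

text \<open>The minimum exists for every finite class, in particular for \<^term>\<open>representable_upto R C c\<close>
  under \<^term>\<open>assumption_E C\<close>.\<close>

definition length_complexity :: "(word \<Rightarrow> bool) set \<Rightarrow> nat" where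
  "length_complexity F =
     (LEAST n. \<forall>f \<in> F. \<forall>f' \<in> F. f \<noteq> f' \<longrightarrow> (\<exists>x. length x \<le> n \<and> f x \<noteq> f' x))"


subsection \<open>Length generalization\<close>

definition training_set :: "nat \<Rightarrow> (word \<Rightarrow> bool) \<Rightarrow> (word \<times> bool) set" where
  "training_set N f = {(x, f x) | x. length x \<le> N}"

text \<open>
  A machine receives a training set as the list of its elements in a canonical order that depends
  only on \<open>N\<close>; thus the list carries exactly the information of the set.
\<close>

definition words_upto :: "nat \<Rightarrow> word list" where
  "words_upto N = concat (map (\<lambda>n. List.n_lists n [False, True]) [0..<Suc N])"

definition training_list :: "nat \<Rightarrow> (word \<Rightarrow> bool) \<Rightarrow> (word \<times> bool) list" where
  "training_list N f = map (\<lambda>x. (x, f x)) (words_upto N)"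

lemma set_words_upto: "set (words_upto N) = {x. length x \<le> N}"
proof -
  have "set (List.n_lists n [False, True]) = {x. length x = n}" for n
    unfolding set_n_lists by (simp add: UNIV_bool[symmetric] insert_commute)
  then show ?thesis
    by (auto simp add: words_upto_def set_eq_iff less_Suc_eq_le simp del: upt_Suc)
qed

lemma set_training_list: "set (training_list N f) = training_set N f"
  by (auto simp: training_list_def training_set_def set_words_upto)

lemma training_list_eq_iff:
  "training_list N f = training_list N' f' \<longleftrightarrow> training_set N f = training_set N' f'"
proof
  assume "training_list N f = training_list N' f'"
  then show "training_set N f = training_set N' f'" by (metis set_training_list)
next
  assume eq: "training_set N f = training_set N' f'"
  have le: "n \<le> m" if "training_set n g \<subseteq> training_set m h" for n m g h
  proof -
    have "(replicate n True, g (replicate n True)) \<in> training_set n g"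
      by (simp add: training_set_def)
    then have "(replicate n True, g (replicate n True)) \<in> training_set m h"
      using that by blast
    then show ?thesis by (simp add: training_set_def)
  qed
  have N: "N = N'"
    using le[of N f N' f'] le[of N' f' N f] eq by simp
  have *: "f x = f' x" if "length x \<le> N" for x
  proof -
    have "(x, f x) \<in> training_set N f" using that by (simp add: training_set_def)
    then have "(x, f x) \<in> training_set N' f'" unfolding eq .
    then show ?thesis by (simp add: training_set_def)
  qed
  show "training_list N f = training_list N' f'"
    unfolding training_list_def N[symmetric]
  proof (rule map_cong[OF refl])
    fix x assume "x \<in> set (words_upto N)"
    then have "length x \<le> N" by (simp add: set_words_upto)
    then show "(x, f x) = (x, f' x)" by (simp add: *)
  qed
qed

definition training_word :: "nat \<Rightarrow> (word \<Rightarrow> bool) \<Rightarrow> word" where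
  "training_word N f = code_list (code_pair code_word (\<lambda>b. [b])) (training_list N f)"

definition learning_algorithm :: "tm \<Rightarrow> tm \<Rightarrow> bool" where
  "learning_algorithm R A \<longleftrightarrow> well_formed A \<and>
     (\<forall>f \<in> representable R. \<forall>N. \<exists>p. yields A (training_word N f) p)"

definition nonasymptotic_length_generalization :: "tm \<Rightarrow> (word \<Rightarrow> nat) \<Rightarrow> bool" where
  "nonasymptotic_length_generalization R C \<longleftrightarrow>
     (\<exists>A N. learning_algorithm R A \<and> computable code_nat code_nat N \<and>
        (\<forall>f \<in> representable R. \<forall>N' \<ge> N (complexity R C f).
           \<exists>p. yields A (training_word N' f) p \<and> denotation R p = f))"

end

theory Submission
  imports Defs
begin

text \<open>
  If equivalence is decidable, a bound on the length complexity at \<open>c\<close> is found by listing all words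
  of complexity at most \<open>c\<close> and searching for a length that separates the inequivalent pairs.
  Given a bound \<open>h\<close>, two words \<open>p\<close>, \<open>q\<close> are equivalent iff their functions agree up to length
  \<open>h (C p + C q)\<close>, and the learner that returns the first word of the enumeration consistent with the
  data succeeds from length \<open>h c\<close> on.  Given a learner with sample size \<open>N\<close>, the sum of \<open>N i\<close> over
  \<open>i \<le> c\<close> bounds the length complexity at \<open>c\<close>, since functions with equal data are learned as one.

  The Turing machines are obtained from a small language of functions on binary trees, compiled to
  machines with four tapes used as stacks.  Any given machine enters such programs only through
  its description, by simulation; the same simulator evaluates \<open>R(p)\<close>.
\<close>

subsection \<open>Compiling stack programs to Turing machines\<close>

text \<open>Equality of two total functions concerns infinitely many inputs. What makes it finite is
  that each class \<open>representable_upto R C c\<close> is finite, so some length separates its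
  members; only the size of that length is unknown. Searching for it requires knowing which pairs
  will never separate, and exactly this is what a decider tells. For the learner, the non-decreasing
  order of the enumeration keeps the first consistent word in the same finite class as the target.
  The obstacle is computability in the literal sense of machines and tapes. Since \<open>R\<close>
  prints descriptions, evaluation must be uniform in \<open>p\<close>: a universal machine is
  unavoidable, and once it exists no machine ever has to be composed with another. Trees serve as
  data because they are self-delimiting on a stack and hold numbers, lists, rules and configurations
  alike. All semantics are big-step relations, and only the direction from a derivation to a halting
  run is proved. Divergence is the absence of a derivation and never has to be reasoned about;
  partial programs are handled by restricting the domain.\<close>

type_synonym label_code = "(nat \<times> (sym \<Rightarrow> nat \<times> sym \<times> move)) list"

text \<open>A rule must act on every tape, while a label concerns the single tape \<open>i\<close>.
  On the others the scanned symbol is written back with \<open>Stay\<close>, which changes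
  nothing.\<close>

definition rule_of :: "label_code \<Rightarrow> nat \<times> sym list \<Rightarrow> nat \<times> (sym \<times> move) list" where
  "rule_of P = (\<lambda>(q, ss). case P ! q of (i, d) \<Rightarrow>
     (fst (d (ss ! i)), (map (\<lambda>s. (s, Stay)) ss)[i := snd (d (ss ! i))]))"

text \<open>The table lists every label with every vector of scanned symbols, so inside the code
  some rule always applies and the label \<open>length P\<close> halts.\<close>

definition machine_of :: "nat \<Rightarrow> label_code \<Rightarrow> tm" where
  "machine_of k P = TM k (map (\<lambda>x. (x, rule_of P x))
     (List.product [0..<length P] (List.n_lists k [None, Some False, Some True])))"

lemma set_n_lists_sym: "set (List.n_lists k [None, Some False, Some True]) = {ss. length ss = k}"
proof -
  have "(UNIV :: sym set) = {None, Some False, Some True}"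
    by (auto simp: UNIV_option_conv UNIV_bool)
  then show ?thesis by (auto simp: set_n_lists)
qed

lemma well_formed_machine_of: "0 < k \<Longrightarrow> well_formed (machine_of k P)"
  by (auto simp: well_formed_def machine_of_def rule_of_def set_n_lists_sym split: prod.splits)

lemma map_of_machine_of:
  "length ss = k \<Longrightarrow> map_of (rules (machine_of k P)) (q, ss) =
     (if q < length P then Some (rule_of P (q, ss)) else None)"
  by (auto simp: machine_of_def map_of_map_restrict set_n_lists_sym restrict_map_def)

lemma step_machine_of:
  assumes "length ts = k" "q < length P" "i < k" "P ! q = (i, d)" "d ((ts ! i) 0) = (q', a)"
  shows "step (machine_of k P) (q, ts) = Some (q', ts[i := act a (ts ! i)])"
proof -
  have "map2 act ((map (\<lambda>t. (t 0, Stay)) ts)[i := a]) ts = ts[i := act a (ts ! i)]"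
    using assms by (intro nth_equalityI) (auto simp: nth_list_update)
  then show ?thesis
    using assms by (simp add: map_of_machine_of rule_of_def comp_def)
qed

lemma step_machine_of_halt:
  "length ts = k \<Longrightarrow> step (machine_of k P) (length P, ts) = None"
  by (simp add: map_of_machine_of)

section \<open>Structured stack programs and their labelled code\<close>

datatype com =
    Skip
  | Push nat bool
  | Pop nat
  | Then com com (infixr ";;" 60)
  | Test nat "sym \<Rightarrow> bool" com com
  | While nat "sym \<Rightarrow> bool" com

fun top_sym :: "word \<Rightarrow> sym" where
  "top_sym [] = None"
| "top_sym (b # w) = Some b"

text \<open>Popping an empty stack has no derivation: the head would pass the blank that ends the
  stack and reach cells about which nothing is known.\<close>

inductive exec :: "com \<Rightarrow> (nat \<Rightarrow> word) \<Rightarrow> (nat \<Rightarrow> word) \<Rightarrow> bool" where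
  exec_Skip: "exec Skip s s"
| exec_Push: "exec (Push i b) s (s(i := b # s i))"
| exec_Pop: "s i = b # w \<Longrightarrow> exec (Pop i) s (s(i := w))"
| exec_Then: "exec c s t \<Longrightarrow> exec d t u \<Longrightarrow> exec (c ;; d) s u"
| exec_Test_True: "p (top_sym (s i)) \<Longrightarrow> exec c s t \<Longrightarrow> exec (Test i p c d) s t"
| exec_Test_False: "\<not> p (top_sym (s i)) \<Longrightarrow> exec d s t \<Longrightarrow> exec (Test i p c d) s t"
| exec_While_True: "p (top_sym (s i)) \<Longrightarrow> exec c s t \<Longrightarrow> exec (While i p c) t u \<Longrightarrow> exec (While i p c) s u"
| exec_While_False: "\<not> p (top_sym (s i)) \<Longrightarrow> exec (While i p c) s s"

text \<open>\<open>Push\<close> takes two labels because a machine action writes before it moves: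
  one label moves left, the next one writes.\<close>

fun code_size :: "com \<Rightarrow> nat" where
  "code_size Skip = 1"
| "code_size (Push i b) = 2"
| "code_size (Pop i) = 1"
| "code_size (c ;; d) = code_size c + code_size d"
| "code_size (Test i p c d) = Suc (code_size c + code_size d)"
| "code_size (While i p c) = Suc (code_size c)"

text \<open>\<open>code c n m\<close> is to be placed at label \<open>n\<close> and leaves to label \<open>m\<close>.\<close>

fun code :: "com \<Rightarrow> nat \<Rightarrow> nat \<Rightarrow> label_code" where
  "code Skip n m = [(0, \<lambda>s. (m, s, Stay))]"
| "code (Push i b) n m = [(i, \<lambda>s. (Suc n, s, Go_Left)), (i, \<lambda>s. (m, Some b, Stay))]"
| "code (Pop i) n m = [(i, \<lambda>s. (m, s, Go_Right))]"
| "code (c ;; d) n m = code c n (n + code_size c) @ code d (n + code_size c) m"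
| "code (Test i p c d) n m =
     (i, \<lambda>s. (if p s then Suc n else Suc n + code_size c, s, Stay)) #
     code c (Suc n) m @ code d (Suc n + code_size c) m"
| "code (While i p c) n m =
     (i, \<lambda>s. (if p s then Suc n else m, s, Stay)) # code c (Suc n) n"

text \<open>\<open>Skip\<close> asks for \<open>0 < k\<close> because its label acts, vacuously, on
  tape 0. Hence every admissible program has at least one tape.\<close>

fun stacks_below :: "nat \<Rightarrow> com \<Rightarrow> bool" where
  "stacks_below k Skip \<longleftrightarrow> 0 < k"
| "stacks_below k (Push i b) \<longleftrightarrow> i < k"
| "stacks_below k (Pop i) \<longleftrightarrow> i < k"
| "stacks_below k (c ;; d) \<longleftrightarrow> stacks_below k c \<and> stacks_below k d"
| "stacks_below k (Test i p c d) \<longleftrightarrow> i < k \<and> stacks_below k c \<and> stacks_below k d"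
| "stacks_below k (While i p c) \<longleftrightarrow> i < k \<and> stacks_below k c"

lemma length_code [simp]: "length (code c n m) = code_size c"
  by (induction c n m rule: code.induct) auto

definition located :: "label_code \<Rightarrow> nat \<Rightarrow> label_code \<Rightarrow> bool" where
  "located P n Q \<longleftrightarrow> (\<exists>xs ys. P = xs @ Q @ ys \<and> length xs = n)"

lemma located_append:
  assumes "located P n (Q @ Q')"
  shows "located P n Q" "located P (n + length Q) Q'"
proof -
  obtain xs ys where *: "P = xs @ (Q @ Q') @ ys" "length xs = n"
    using assms unfolding located_def by blast
  have "P = xs @ Q @ (Q' @ ys) \<and> length xs = n" using * by simp
  then show "located P n Q" unfolding located_def by blast
  have "P = (xs @ Q) @ Q' @ ys \<and> length (xs @ Q) = n + length Q" using * by simp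
  then show "located P (n + length Q) Q'" unfolding located_def by blast
qed

lemma located_Cons:
  assumes "located P n (x # Q)"
  shows "n < length P" "P ! n = x" "located P (Suc n) Q"
proof -
  show "n < length P" "P ! n = x"
    using assms by (auto simp: located_def)
  show "located P (Suc n) Q"
    using assms located_append(2)[of P n "[x]" Q] by simp
qed

text \<open>Only the cells from the head to the first blank are prescribed. Remains of popped
  symbols to the left are arbitrary, so a stack state has many tape lists and \<open>runs_to\<close>
  must quantify over all of them.\<close>

definition holds_stacks :: "nat \<Rightarrow> (nat \<Rightarrow> word) \<Rightarrow> tape list \<Rightarrow> bool" where
  "holds_stacks k s ts \<longleftrightarrow> length ts = k \<and> (\<forall>i<k. shows_word (ts ! i) (s i))"

definition runs_to :: "nat \<Rightarrow> label_code \<Rightarrow> nat \<Rightarrow> (nat \<Rightarrow> word) \<Rightarrow> nat \<Rightarrow> (nat \<Rightarrow> word) \<Rightarrow> bool" where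
  "runs_to k P q s q' s' \<longleftrightarrow> (\<forall>ts. holds_stacks k s ts \<longrightarrow>
     (\<exists>ts'. (\<lambda>c c'. step (machine_of k P) c = Some c')\<^sup>*\<^sup>* (q, ts) (q', ts') \<and> holds_stacks k s' ts'))"

lemma runs_to_trans: "runs_to k P q s q' s' \<Longrightarrow> runs_to k P q' s' q'' s'' \<Longrightarrow> runs_to k P q s q'' s''"
  unfolding runs_to_def by (meson rtranclp_trans)

lemma shows_word_top: "shows_word t w \<Longrightarrow> t 0 = top_sym w"
  by (cases w) (auto simp: shows_word_def)

lemma runs_to_stay:
  assumes "q < length P" "i < k" "P ! q = (i, d)" "d (top_sym (s i)) = (q', top_sym (s i), Stay)"
  shows "runs_to k P q s q' s"
  unfolding runs_to_def
proof (intro allI impI)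
  fix ts assume ts: "holds_stacks k s ts"
  then have t: "(ts ! i) 0 = top_sym (s i)" "length ts = k"
    using assms(2) shows_word_top by (auto simp: holds_stacks_def)
  have "act (top_sym (s i), Stay) (ts ! i) = ts ! i" unfolding t(1)[symmetric] by simp
  then have "step (machine_of k P) (q, ts) = Some (q', ts)"
    using step_machine_of[OF t(2) assms(1-3)] assms(4) t(1) by simp
  then show "\<exists>ts'. (\<lambda>c c'. step (machine_of k P) c = Some c')\<^sup>*\<^sup>* (q, ts) (q', ts') \<and> holds_stacks k s ts'"
    using ts by blast
qed

lemma runs_to_pop:
  assumes "q < length P" "i < k" "P ! q = (i, \<lambda>x. (q', x, Go_Right))" "s i = b # w"
  shows "runs_to k P q s q' (s(i := w))"
  unfolding runs_to_def
proof (intro allI impI)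
  fix ts assume ts: "holds_stacks k s ts"
  then have l: "length ts = k" and i: "shows_word (ts ! i) (b # w)"
    using assms(2,4) by (auto simp: holds_stacks_def)
  let ?t = "act ((ts ! i) 0, Go_Right) (ts ! i)"
  have "shows_word ?t w"
    using i by (auto simp: shows_word_def nat_add_distrib add.commute)
  then have "holds_stacks k (s(i := w)) (ts[i := ?t])"
    using ts assms(2) by (auto simp: holds_stacks_def nth_list_update)
  moreover have "step (machine_of k P) (q, ts) = Some (q', ts[i := ?t])"
    using step_machine_of[OF l assms(1-3)] by simp
  ultimately show "\<exists>ts'. (\<lambda>c c'. step (machine_of k P) c = Some c')\<^sup>*\<^sup>* (q, ts) (q', ts') \<and>
      holds_stacks k (s(i := w)) ts'" by blast
qed

lemma runs_to_push:
  assumes "q < length P" "Suc q < length P" "i < k"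
    and "P ! q = (i, \<lambda>x. (Suc q, x, Go_Left))" "P ! Suc q = (i, \<lambda>x. (q', Some b, Stay))"
  shows "runs_to k P q s q' (s(i := b # s i))"
  unfolding runs_to_def
proof (intro allI impI)
  fix ts assume ts: "holds_stacks k s ts"
  then have l: "length ts = k" and i: "shows_word (ts ! i) (s i)"
    using assms(3) by (auto simp: holds_stacks_def)
  let ?t = "act ((ts ! i) 0, Go_Left) (ts ! i)"
  let ?u = "act (Some b, Stay) ?t"
  have "shows_word ?u (b # s i)"
    using i by (auto simp: shows_word_def nth_Cons split: nat.splits)
  then have "holds_stacks k (s(i := b # s i)) (ts[i := ?u])"
    using ts assms(3) by (auto simp: holds_stacks_def nth_list_update)
  moreover have "step (machine_of k P) (q, ts) = Some (Suc q, ts[i := ?t])"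
    using step_machine_of[OF l assms(1,3,4)] by simp
  moreover have "step (machine_of k P) (Suc q, ts[i := ?t]) = Some (q', ts[i := ?u])"
    using step_machine_of[of "ts[i := ?t]" k "Suc q" P i] assms(2,3,5) l by simp
  ultimately show "\<exists>ts'. (\<lambda>c c'. step (machine_of k P) c = Some c')\<^sup>*\<^sup>* (q, ts) (q', ts') \<and>
      holds_stacks k (s(i := b # s i)) ts'"
    by (meson converse_rtranclp_into_rtranclp rtranclp.rtrancl_refl)
qed

text \<open>Induction on the derivation, not on the command, provides a hypothesis for the remaining
  rounds of a loop. The labels are generalized because a loop body exits to the label of its own
  loop.\<close>

lemma runs_to_code:
  "exec c s t \<Longrightarrow> stacks_below k c \<Longrightarrow> located P n (code c n m) \<Longrightarrow> runs_to k P n s m t"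
proof (induction arbitrary: n m rule: exec.induct)
  case (exec_Skip s)
  then show ?case
    using runs_to_stay[of n P 0 k "\<lambda>s. (m, s, Stay)" s m] by (simp add: located_Cons)
next
  case (exec_Push i b s)
  then have l: "located P n [(i, \<lambda>s. (Suc n, s, Go_Left)), (i, \<lambda>s. (m, Some b, Stay))]"
    by simp
  show ?case
    using located_Cons[OF l] located_Cons[OF located_Cons(3)[OF l]] exec_Push
    by (intro runs_to_push) simp_all
next
  case (exec_Pop s i b w)
  then have l: "located P n [(i, \<lambda>s. (m, s, Go_Right))]" by simp
  show ?case
    using located_Cons[OF l] exec_Pop by (intro runs_to_pop) simp_all
next
  case (exec_Then c s t d u)
  then show ?case using located_append by (fastforce intro: runs_to_trans)
next
  case (exec_Test_True p s i c t d)
  let ?x = "(i, \<lambda>s. (if p s then Suc n else Suc n + code_size c, s, Stay))"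
  have l: "located P n (?x # code c (Suc n) m @ code d (Suc n + code_size c) m)"
    using exec_Test_True.prems by simp
  have "runs_to k P n s (Suc n) s"
    using runs_to_stay[OF located_Cons(1)[OF l] _ located_Cons(2)[OF l]] exec_Test_True by simp
  moreover have "runs_to k P (Suc n) s m t"
    using exec_Test_True located_append(1)[OF located_Cons(3)[OF l]] by simp
  ultimately show ?case by (rule runs_to_trans)
next
  case (exec_Test_False p s i d t c)
  let ?x = "(i, \<lambda>s. (if p s then Suc n else Suc n + code_size c, s, Stay))"
  have l: "located P n (?x # code c (Suc n) m @ code d (Suc n + code_size c) m)"
    using exec_Test_False.prems by simp
  have "runs_to k P n s (Suc n + code_size c) s"
    using runs_to_stay[OF located_Cons(1)[OF l] _ located_Cons(2)[OF l]] exec_Test_False by simp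
  moreover have "runs_to k P (Suc n + code_size c) s m t"
    using exec_Test_False located_append(2)[OF located_Cons(3)[OF l]] by simp
  ultimately show ?case by (rule runs_to_trans)
next
  case (exec_While_True p s i c t u)
  let ?x = "(i, \<lambda>s. (if p s then Suc n else m, s, Stay))"
  have l: "located P n (?x # code c (Suc n) n)"
    using exec_While_True.prems by simp
  have "runs_to k P n s (Suc n) s"
    using runs_to_stay[OF located_Cons(1)[OF l] _ located_Cons(2)[OF l]] exec_While_True by simp
  moreover have "runs_to k P (Suc n) s n t"
    using exec_While_True located_Cons(3)[OF l] by simp
  moreover have "runs_to k P n t m u"
    using exec_While_True by blast
  ultimately show ?case by (blast intro: runs_to_trans)
next
  case (exec_While_False p s i c)
  let ?x = "(i, \<lambda>s. (if p s then Suc n else m, s, Stay))"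
  have l: "located P n (?x # code c (Suc n) n)"
    using exec_While_False.prems by simp
  show ?case
    using runs_to_stay[OF located_Cons(1)[OF l] _ located_Cons(2)[OF l]] exec_While_False by simp
qed

lemma shows_word_tape_of: "shows_word (tape_of w) w"
  by (simp add: shows_word_def tape_of_def)

text \<open>The exit label is the length of the code, where no rule exists, so leaving the program
  is halting. The tapes after the first are initially blank and show empty stacks.\<close>

lemma yields_of_exec:
  assumes "stacks_below k c"
  obtains M where "well_formed M"
    "\<And>x t. exec c (\<lambda>i. if i = 0 then x else []) t \<Longrightarrow> yields M x (t 0)"
proof
  let ?P = "code c 0 (code_size c)"
  let ?M = "machine_of k ?P"
  have k: "0 < k" using assms by (induction c) auto
  show "well_formed ?M" using k by (rule well_formed_machine_of)
  fix x t assume e: "exec c (\<lambda>i. if i = 0 then x else []) t"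
  have "located ?P 0 ?P" by (auto simp: located_def)
  from runs_to_code[OF e assms this]
  have r: "runs_to k ?P 0 (\<lambda>i. if i = 0 then x else []) (code_size c) t" .
  have "holds_stacks k (\<lambda>i. if i = 0 then x else []) (snd (initial ?M x))"
    using k by (auto simp: holds_stacks_def initial_def machine_of_def nth_Cons shows_word_tape_of split: nat.splits)
  with r obtain ts where ts: "(\<lambda>c c'. step ?M c = Some c')\<^sup>*\<^sup>* (0, snd (initial ?M x)) (code_size c, ts)"
    "holds_stacks k t ts" unfolding runs_to_def by blast
  have "step ?M (code_size c, ts) = None"
    using step_machine_of_halt[of ts k ?P] ts(2) by (simp add: holds_stacks_def)
  moreover have "shows_word (hd ts) (t 0)"
    using ts(2) k by (cases ts) (auto simp: holds_stacks_def)
  moreover have "(0, snd (initial ?M x)) = initial ?M x" by (simp add: initial_def)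
  ultimately show "yields ?M x (t 0)" using ts(1) unfolding yields_def by metis
qed


subsection \<open>A programming language on binary trees\<close>

datatype tree = Leaf | Node tree tree

fun left :: "tree \<Rightarrow> tree" where
  "left Leaf = Leaf"
| "left (Node a b) = a"

fun right :: "tree \<Rightarrow> tree" where
  "right Leaf = Leaf"
| "right (Node a b) = b"

datatype tprog =
    Ident
  | Empty
  | Lft
  | Rgt
  | Comp tprog tprog
  | Pair tprog tprog
  | Cond tprog tprog tprog
  | Loop tprog tprog

inductive ev :: "tprog \<Rightarrow> tree \<Rightarrow> tree \<Rightarrow> bool" where
  ev_Ident: "ev Ident x x"
| ev_Empty: "ev Empty x Leaf"
| ev_Lft: "ev Lft x (left x)"
| ev_Rgt: "ev Rgt x (right x)"
| ev_Comp: "ev f x y \<Longrightarrow> ev g y z \<Longrightarrow> ev (Comp g f) x z"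
| ev_Pair: "ev f x y \<Longrightarrow> ev g x z \<Longrightarrow> ev (Pair f g) x (Node y z)"
| ev_Cond_Node: "ev p x (Node a b) \<Longrightarrow> ev f x y \<Longrightarrow> ev (Cond p f g) x y"
| ev_Cond_Leaf: "ev p x Leaf \<Longrightarrow> ev g x y \<Longrightarrow> ev (Cond p f g) x y"
| ev_Loop_Node: "ev p x (Node a b) \<Longrightarrow> ev f x y \<Longrightarrow> ev (Loop p f) y z \<Longrightarrow> ev (Loop p f) x z"
| ev_Loop_Leaf: "ev p x Leaf \<Longrightarrow> ev (Loop p f) x x"

text \<open>Preorder is self-delimiting: the end of the top tree can be found although other trees
  lie below it on the same stack.\<close>

fun ser :: "tree \<Rightarrow> word" where
  "ser Leaf = [False]"
| "ser (Node a b) = True # ser a @ ser b"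

text \<open>
  The tree under evaluation lies serialized on stack 0; stack 1 keeps copies of trees needed
  later; stack 2 counts, in unary, the subtrees still to be read; stack 3 is a reversing buffer.
\<close>

definition stacks :: "word \<Rightarrow> word \<Rightarrow> word \<Rightarrow> word \<Rightarrow> nat \<Rightarrow> word" where
  "stacks a b c d = (\<lambda>i. if i = 0 then a else if i = 1 then b else if i = 2 then c
                         else if i = 3 then d else [])"

lemma stacks_simps [simp]:
  "stacks a b c d 0 = a" "stacks a b c d (Suc 0) = b" "stacks a b c d 2 = c" "stacks a b c d 3 = d"
  "(stacks a b c d)(0 := x) = stacks x b c d" "(stacks a b c d)(Suc 0 := x) = stacks a x c d"
  "(stacks a b c d)(2 := x) = stacks a b x d" "(stacks a b c d)(3 := x) = stacks a b c x"
  by (auto simp: stacks_def)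

lemma exec_Push_eq: "t = s(i := b # s i) \<Longrightarrow> exec (Push i b) s t"
  using exec_Push by simp

lemma exec_Pop_eq: "s i = b # w \<Longrightarrow> t = s(i := w) \<Longrightarrow> exec (Pop i) s t"
  using exec_Pop by simp

lemma exec_Push_stacks:
  "exec (Push 0 x) (stacks a b c d) (stacks (x # a) b c d)"
  "exec (Push 1 x) (stacks a b c d) (stacks a (x # b) c d)"
  "exec (Push 2 x) (stacks a b c d) (stacks a b (x # c) d)"
  "exec (Push 3 x) (stacks a b c d) (stacks a b c (x # d))"
  by (auto intro: exec_Push_eq)

lemma exec_Pop_stacks:
  "exec (Pop 0) (stacks (x # a) b c d) (stacks a b c d)"
  "exec (Pop 1) (stacks a (x # b) c d) (stacks a b c d)"
  "exec (Pop 2) (stacks a b (x # c) d) (stacks a b c d)"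
  "exec (Pop 3) (stacks a b c (x # d)) (stacks a b c d)"
  by (auto intro: exec_Pop_eq)

lemmas exec_stacks = exec_Then exec_Push_stacks exec_Pop_stacks exec_Skip

section \<open>Moving serialized trees between stacks\<close>

abbreviation is_one :: "sym \<Rightarrow> bool" where "is_one \<equiv> \<lambda>s. s = Some True"
abbreviation nonblank :: "sym \<Rightarrow> bool" where "nonblank \<equiv> \<lambda>s. s \<noteq> None"

text \<open>Each round settles one pending subtree: the bit of a \<open>Leaf\<close> finishes it,
  the bit of a \<open>Node\<close> replaces it by two. The counter therefore runs out exactly at the
  end of the tree.\<close>

definition grab_loop :: "nat \<Rightarrow> com" where
  "grab_loop i = While 2 nonblank (Pop 2 ;; Test i is_one
     (Pop i ;; Push 3 True ;; Push 2 True ;; Push 2 True)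
     (Pop i ;; Push 3 False))"

definition grab :: "nat \<Rightarrow> com" where
  "grab i = Push 2 True ;; grab_loop i"

text \<open>The loop does not stop between the two subtrees of a node, so the claim is put in
  continuation form: a run from the state after \<open>x\<close> extends backwards to one from the
  state before \<open>x\<close>. In the \<open>Node\<close> case the second subtree is therefore
  treated first.\<close>

lemma grab_loop_0:
  "exec (grab_loop 0) (stacks r b c (rev (ser x) @ d)) t \<Longrightarrow>
   exec (grab_loop 0) (stacks (ser x @ r) b (True # c) d) t"
proof (induction x arbitrary: r c d)
  case Leaf
  show ?case unfolding grab_loop_def
    apply (rule exec_While_True)
      apply simp
     apply (rule exec_Then, rule exec_stacks, rule exec_Test_False)
      apply simp
     apply simp
     apply (rule exec_stacks)+
    using Leaf by (simp add: grab_loop_def)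
next
  case (Node x1 x2)
  have "exec (grab_loop 0) (stacks (ser x2 @ r) b (True # c) (rev (ser x1) @ True # d)) t"
    by (rule Node.IH(2)) (use Node.prems in simp)
  from Node.IH(1)[OF this]
  have *: "exec (grab_loop 0) (stacks (ser x1 @ ser x2 @ r) b (True # True # c) (True # d)) t" .
  show ?case unfolding grab_loop_def
    apply (rule exec_While_True)
      apply simp
     apply (rule exec_Then, rule exec_stacks, rule exec_Test_True)
      apply simp
     apply simp
     apply (rule exec_stacks)+
    using * by (simp add: grab_loop_def)
qed

lemma grab_loop_1:
  "exec (grab_loop 1) (stacks a r c (rev (ser x) @ d)) t \<Longrightarrow>
   exec (grab_loop 1) (stacks a (ser x @ r) (True # c) d) t"
proof (induction x arbitrary: r c d)
  case Leaf
  show ?case unfolding grab_loop_def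
    apply (rule exec_While_True)
      apply simp
     apply (rule exec_Then, rule exec_stacks, rule exec_Test_False)
      apply simp
     apply simp
     apply (rule exec_stacks[simplified])+
    using Leaf by (simp add: grab_loop_def)
next
  case (Node x1 x2)
  have "exec (grab_loop 1) (stacks a (ser x2 @ r) (True # c) (rev (ser x1) @ True # d)) t"
    by (rule Node.IH(2)) (use Node.prems in simp)
  from Node.IH(1)[OF this]
  have *: "exec (grab_loop 1) (stacks a (ser x1 @ ser x2 @ r) (True # True # c) (True # d)) t" .
  show ?case unfolding grab_loop_def
    apply (rule exec_While_True)
      apply simp
     apply (rule exec_Then, rule exec_stacks, rule exec_Test_True)
      apply simp
     apply simp
     apply (rule exec_stacks[simplified])+
    using * by (simp add: grab_loop_def)
qed

lemma exec_grab:
  "exec (grab 0) (stacks (ser x @ r) b [] d) (stacks r b [] (rev (ser x) @ d))"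
  "exec (grab 1) (stacks a (ser x @ r) [] d) (stacks a r [] (rev (ser x) @ d))"
  unfolding grab_def
   apply (rule exec_Then, rule exec_stacks, rule grab_loop_0)
   apply (unfold grab_loop_def, rule exec_While_False, simp)
  apply (rule exec_Then, rule exec_stacks, fold grab_loop_def, rule grab_loop_1)
  apply (unfold grab_loop_def, rule exec_While_False, simp)
  done

text \<open>Emptying the buffer reverses it a second time, so a grabbed tree is laid down in its
  original order, at the places chosen by \<open>f\<close>.\<close>

definition spill :: "(bool \<Rightarrow> com) \<Rightarrow> com" where
  "spill f = While 3 nonblank (Test 3 is_one (Pop 3 ;; f True) (Pop 3 ;; f False))"

lemma exec_spill:
  assumes "\<And>x a b d. exec (f x) (stacks a b [] d) (stacks (g x a) (h x b) [] d)"
  shows "exec (spill f) (stacks a b [] d) (stacks (fold g d a) (fold h d b) [] [])"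
proof (induction d arbitrary: a b)
  case Nil
  show ?case unfolding spill_def by (auto intro: exec_While_False)
next
  case (Cons x d)
  have "exec (Test 3 is_one (Pop 3 ;; f True) (Pop 3 ;; f False))
          (stacks a b [] (x # d)) (stacks (g x a) (h x b) [] d)"
  proof (cases x)
    case True
    then show ?thesis
      by (auto intro!: exec_Test_True exec_Then[OF exec_Pop_stacks(4)] assms)
  next
    case False
    then show ?thesis
      by (auto intro!: exec_Test_False exec_Then[OF exec_Pop_stacks(4)] assms)
  qed
  then show ?case
    using Cons.IH[of "g x a" "h x b"] unfolding spill_def by (auto intro: exec_While_True)
qed

lemma fold_const: "fold (\<lambda>_ x. x) xs y = y"
  by (induction xs) auto

lemma exec_spill_0: "exec (spill (Push 0)) (stacks a b [] d) (stacks (rev d @ a) b [] [])"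
  using exec_spill[of "Push 0" Cons "\<lambda>_ b. b" a b d]
  by (simp add: exec_Push_stacks fold_const fold_Cons_rev)

lemma exec_spill_1: "exec (spill (Push 1)) (stacks a b [] d) (stacks a (rev d @ b) [] [])"
  using exec_spill[of "Push 1" "\<lambda>_ b. b" Cons a b d]
  by (simp add: exec_Push_stacks[simplified] fold_const fold_Cons_rev)

lemma exec_spill_01:
  "exec (spill (\<lambda>x. Push 0 x ;; Push 1 x)) (stacks a b [] d) (stacks (rev d @ a) (rev d @ b) [] [])"
proof -
  have "exec (Push 0 x ;; Push 1 x) (stacks a b [] d) (stacks (x # a) (x # b) [] d)" for x a b d
    by (rule exec_stacks)+
  from exec_spill[of _ Cons Cons, OF this] show ?thesis by (simp add: fold_Cons_rev)
qed

lemma exec_spill_none: "exec (spill (\<lambda>_. Skip)) (stacks a b [] d) (stacks a b [] [])"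
  using exec_spill[of "\<lambda>_. Skip" "\<lambda>_ b. b" "\<lambda>_ b. b" a b d] by (simp add: exec_Skip fold_const)

section \<open>Compiling tree programs to stack programs\<close>

definition drop_tree :: com where "drop_tree = grab 0 ;; spill (\<lambda>_. Skip)"
definition save :: com where "save = grab 0 ;; spill (\<lambda>x. Push 0 x ;; Push 1 x)"
definition restore :: com where "restore = grab 1 ;; spill (Push 0)"
definition move_away :: com where "move_away = grab 0 ;; spill (Push 1)"

lemma exec_drop_tree: "exec drop_tree (stacks (ser x @ r) b [] []) (stacks r b [] [])"
  unfolding drop_tree_def
  by (rule exec_Then[OF exec_grab(1)]) (rule exec_spill_none)

lemma exec_save: "exec save (stacks (ser x @ r) b [] []) (stacks (ser x @ r) (ser x @ b) [] [])"
  unfolding save_def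
  using exec_Then[OF exec_grab(1) exec_spill_01, of x r b "[]"] by simp

lemma exec_restore: "exec restore (stacks a (ser x @ r) [] []) (stacks (ser x @ a) r [] [])"
  unfolding restore_def
  using exec_Then[OF exec_grab(2) exec_spill_0, of a x r "[]"] by simp

lemma exec_move_away: "exec move_away (stacks (ser x @ r) b [] []) (stacks r (ser x @ b) [] [])"
  unfolding move_away_def
  using exec_Then[OF exec_grab(1) exec_spill_1, of x r b "[]"] by simp

text \<open>\<open>Pair\<close> evaluates \<open>g\<close> first: the value of \<open>f\<close> has
  to end on top, so that one more bit completes the preorder of the node. Evaluation consumes its
  argument, hence the copy saved on stack 1 before each test.\<close>

fun compile :: "tprog \<Rightarrow> com" where
  "compile Ident = Skip"
| "compile Empty = drop_tree ;; Push 0 False"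
| "compile Lft = Test 0 is_one (Pop 0 ;; move_away ;; drop_tree ;; restore) Skip"
| "compile Rgt = Test 0 is_one (Pop 0 ;; drop_tree) Skip"
| "compile (Comp g f) = compile f ;; compile g"
| "compile (Pair f g) = save ;; compile g ;; restore ;; compile f ;; Push 0 True"
| "compile (Cond p f g) = save ;; compile p ;;
     Test 0 is_one (drop_tree ;; restore ;; compile f) (drop_tree ;; restore ;; compile g)"
| "compile (Loop p f) = save ;; compile p ;;
     While 0 is_one (drop_tree ;; restore ;; compile f ;; save ;; compile p) ;;
     drop_tree ;; restore"

lemma exec_compile:
  "ev f x y \<Longrightarrow> exec (compile f) (stacks (ser x @ a) b [] []) (stacks (ser y @ a) b [] [])"
proof (induction arbitrary: a b rule: ev.induct)
  case (ev_Ident x)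
  then show ?case by (auto intro: exec_Skip)
next
  case (ev_Empty x)
  show ?case by (auto intro: exec_Then[OF exec_drop_tree exec_Push_stacks(1)])
next
  case (ev_Lft x)
  show ?case
  proof (cases x)
    case Leaf
    then show ?thesis by (auto intro!: exec_Test_False exec_Skip)
  next
    case (Node l r)
    then show ?thesis
      by (auto intro!: exec_Test_True exec_Then[OF exec_Pop_stacks(1)] exec_Then[OF exec_move_away]
          exec_Then[OF exec_drop_tree] exec_restore)
  qed
next
  case (ev_Rgt x)
  show ?case
  proof (cases x)
    case Leaf
    then show ?thesis by (auto intro!: exec_Test_False exec_Skip)
  next
    case (Node l r)
    then show ?thesis
      by (auto intro!: exec_Test_True exec_Then[OF exec_Pop_stacks(1)] exec_drop_tree)
  qed
next
  case (ev_Comp f x y g z)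
  show ?case unfolding compile.simps by (rule exec_Then[OF ev_Comp.IH])
next
  case (ev_Pair f x y g z)
  have *: "stacks (ser (Node y z) @ a) b [] [] = stacks (True # ser y @ ser z @ a) b [] []" by simp
  show ?case unfolding compile.simps *
    by (rule exec_Then[OF exec_save] exec_Then[OF ev_Pair.IH(2)] exec_Then[OF exec_restore]
        exec_Then[OF ev_Pair.IH(1)] exec_Push_stacks(1))+
next
  case (ev_Cond_Node p x u v f y g)
  show ?case unfolding compile.simps
    by (rule exec_Then[OF exec_save] exec_Then[OF ev_Cond_Node.IH(1)] exec_Test_True
        exec_Then[OF exec_drop_tree] exec_Then[OF exec_restore] ev_Cond_Node.IH(2) | simp)+
next
  case (ev_Cond_Leaf p x g y f)
  have "exec (drop_tree ;; restore ;; compile g)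
          (stacks (ser Leaf @ a) (ser x @ b) [] []) (stacks (ser y @ a) b [] [])"
    by (rule exec_Then[OF exec_drop_tree], rule exec_Then[OF exec_restore], rule ev_Cond_Leaf.IH(2))
  from exec_Test_False[OF _ this]
  have *: "exec (Test 0 is_one (drop_tree ;; restore ;; compile f) (drop_tree ;; restore ;; compile g))
          (stacks (ser Leaf @ a) (ser x @ b) [] []) (stacks (ser y @ a) b [] [])"
    by simp
  show ?case unfolding compile.simps
    by (rule exec_Then[OF exec_save], rule exec_Then[OF ev_Cond_Leaf.IH(1)], rule *)
next
  case (ev_Loop_Node p x u v f y z)
  let ?W = "While 0 is_one (drop_tree ;; restore ;; compile f ;; save ;; compile p)"
  \<comment> \<open>The induction hypothesis is about a whole compiled loop, whose initial
    \<open>save\<close> and test coincide with the end of the \<open>While\<close> body. Its run is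
    cut after that test; the first piece completes the present round and the second piece supplies
    the later rounds.\<close>
  have "exec (compile (Loop p f)) (stacks (ser y @ a) b [] []) (stacks (ser z @ a) b [] [])"
    by (rule ev_Loop_Node.IH)
  then obtain t where t: "exec (save ;; compile p) (stacks (ser y @ a) b [] []) t"
    "exec (?W ;; drop_tree ;; restore) t (stacks (ser z @ a) b [] [])"
    by (auto elim!: exec.cases[of "_ ;; _"] intro: exec_Then)
  from t(2) obtain t' where t': "exec ?W t t'"
    "exec (drop_tree ;; restore) t' (stacks (ser z @ a) b [] [])"
    by (auto elim!: exec.cases[of "_ ;; _"] intro: exec_Then)
  have "exec (drop_tree ;; restore ;; compile f ;; save ;; compile p)
          (stacks (ser (Node u v) @ a) (ser x @ b) [] []) t"
    by (rule exec_Then[OF exec_drop_tree] exec_Then[OF exec_restore] exec_Then[OF ev_Loop_Node.IH(2)] t(1))+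
  from exec_While_True[OF _ this t'(1)]
  have "exec ?W (stacks (ser (Node u v) @ a) (ser x @ b) [] []) t'"
    by simp
  from exec_Then[OF this t'(2)] show ?case unfolding compile.simps
    by (rule exec_Then[OF exec_save exec_Then[OF ev_Loop_Node.IH(1)]])
next
  case (ev_Loop_Leaf p x f)
  show ?case unfolding compile.simps
    by (rule exec_Then[OF exec_save exec_Then[OF ev_Loop_Leaf.IH(1) exec_Then[OF exec_While_False
        exec_Then[OF exec_drop_tree exec_restore]]]]) simp
qed

lemma stacks_below_compile: "stacks_below 4 (compile f)"
  by (induction f)
    (auto simp: drop_tree_def save_def restore_def move_away_def grab_def grab_loop_def spill_def)

section \<open>Converting raw words to list trees and back\<close>

primrec tree_of_word :: "word \<Rightarrow> tree" where
  "tree_of_word [] = Leaf"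
| "tree_of_word (b # w) = Node (if b then Node Leaf Leaf else Leaf) (tree_of_word w)"

text \<open>The word is first reversed into the buffer, so that the list tree grows from its last
  cell, on top of the \<open>False\<close> of the empty list. The pushed patterns, read from the
  top, are the bit of the list cell followed by the preorder of its head.\<close>

definition read_input :: com where
  "read_input = While 0 nonblank
       (Test 0 is_one (Pop 0 ;; Push 3 True) (Pop 0 ;; Push 3 False)) ;;
     Push 0 False ;;
     spill (\<lambda>x. if x then Push 0 False ;; Push 0 False ;; Push 0 True ;; Push 0 True
                else Push 0 False ;; Push 0 True)"

definition write_output :: com where
  "write_output = While 0 is_one (Pop 0 ;;
       Test 0 is_one (Pop 0 ;; Pop 0 ;; Pop 0 ;; Push 3 True) (Pop 0 ;; Push 3 False)) ;;
     Pop 0 ;; spill (Push 0)"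

lemma exec_read_input:
  "exec read_input (stacks w [] [] []) (stacks (ser (tree_of_word w)) [] [] [])"
proof -
  have 1: "exec (While 0 nonblank
       (Test 0 is_one (Pop 0 ;; Push 3 True) (Pop 0 ;; Push 3 False)))
     (stacks w [] [] d) (stacks [] [] [] (rev w @ d))" for d
  proof (induction w arbitrary: d)
    case Nil
    show ?case by (auto intro: exec_While_False)
  next
    case (Cons x w)
    have "exec (Test 0 is_one (Pop 0 ;; Push 3 True) (Pop 0 ;; Push 3 False))
      (stacks (x # w) [] [] d) (stacks w [] [] (x # d))"
    proof (cases x)
      case True
      then show ?thesis
        by (auto intro!: exec_Test_True exec_Then[OF exec_Pop_stacks(1)] exec_Push_stacks)
    next
      case False
      then show ?thesis
        by (auto intro!: exec_Test_False exec_Then[OF exec_Pop_stacks(1)] exec_Push_stacks)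
    qed
    then show ?case using Cons.IH[of "x # d"] by (auto intro: exec_While_True)
  qed
  let ?g = "\<lambda>x a. if x then True # True # False # False # a else True # False # a"
  have "exec (if x then Push 0 False ;; Push 0 False ;; Push 0 True ;; Push 0 True
              else Push 0 False ;; Push 0 True)
    (stacks a b [] d) (stacks (?g x a) b [] d)" for x a b d
    by (cases x) (auto intro!: exec_Then[OF exec_Push_stacks(1)] exec_Push_stacks)
  from exec_spill[of _ ?g "\<lambda>_ b. b", OF this]
  have "exec (spill (\<lambda>x. if x then Push 0 False ;; Push 0 False ;; Push 0 True ;; Push 0 True
                else Push 0 False ;; Push 0 True))
    (stacks [False] [] [] (rev w)) (stacks (fold ?g (rev w) [False]) [] [] [])"
    by (simp add: fold_const)
  moreover have "fold ?g (rev w) [False] = ser (tree_of_word w)"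
    by (induction w) auto
  ultimately have 2: "exec (spill (\<lambda>x. if x then Push 0 False ;; Push 0 False ;; Push 0 True ;; Push 0 True
                else Push 0 False ;; Push 0 True))
    (stacks [False] [] [] (rev w)) (stacks (ser (tree_of_word w)) [] [] [])"
    by (simp only:)
  show ?thesis
    unfolding read_input_def
    by (rule exec_Then[OF 1[of "[]", unfolded append_Nil2] exec_Then[OF exec_Push_stacks(1) 2]])
qed

lemma exec_write_output:
  "exec write_output (stacks (ser (tree_of_word w)) [] [] []) (stacks w [] [] [])"
proof -
  have 1: "exec (While 0 is_one (Pop 0 ;;
       Test 0 is_one (Pop 0 ;; Pop 0 ;; Pop 0 ;; Push 3 True) (Pop 0 ;; Push 3 False)))
     (stacks (ser (tree_of_word w)) [] [] d) (stacks [False] [] [] (rev w @ d))" for d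
  proof (induction w arbitrary: d)
    case Nil
    show ?case by (auto intro: exec_While_False)
  next
    case (Cons x w)
    have "exec (Pop 0 ;;
       Test 0 is_one (Pop 0 ;; Pop 0 ;; Pop 0 ;; Push 3 True) (Pop 0 ;; Push 3 False))
      (stacks (ser (tree_of_word (x # w))) [] [] d) (stacks (ser (tree_of_word w)) [] [] (x # d))"
    proof (cases x)
      case True
      then show ?thesis
        by (auto intro!: exec_Test_True exec_Then[OF exec_Pop_stacks(1)] exec_Push_stacks)
    next
      case False
      then show ?thesis
        by (auto intro!: exec_Test_False exec_Then[OF exec_Pop_stacks(1)] exec_Push_stacks)
    qed
    then show ?case using Cons.IH[of "x # d"] by (auto intro: exec_While_True)
  qed
  show ?thesis
    unfolding write_output_def
    using exec_spill_0[of "[]" "[]" "rev w"] 1[of "[]"]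
    by (auto intro!: exec_Then[OF 1[of "[]"]] exec_Then[OF exec_Pop_stacks(1)])
qed

theorem yields_of_ev:
  obtains M where "well_formed M"
    "\<And>v w. ev f (tree_of_word v) (tree_of_word w) \<Longrightarrow> yields M v w"
proof -
  let ?c = "read_input ;; compile f ;; write_output"
  have "stacks_below 4 ?c"
    using stacks_below_compile[of f] by (auto simp: read_input_def write_output_def spill_def)
  then obtain M where M: "well_formed M"
    "\<And>x t. exec ?c (\<lambda>i. if i = 0 then x else []) t \<Longrightarrow> yields M x (t 0)"
    using yields_of_exec by metis
  show thesis
  proof
    show "well_formed M" by (rule M(1))
    fix v w assume e: "ev f (tree_of_word v) (tree_of_word w)"
    have "exec ?c (stacks v [] [] []) (stacks w [] [] [])"
      using exec_compile[OF e, of "[]" "[]"]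
      by (auto intro: exec_Then exec_read_input exec_write_output)
    moreover have "stacks v [] [] [] = (\<lambda>i. if i = 0 then v else [])"
      by (auto simp: stacks_def)
    ultimately show "yields M v w" using M(2) by fastforce
  qed
qed


subsection \<open>Effective functions between encoded types\<close>

text \<open>Injectivity is what allows equality of values to be decided by comparing trees, in
  \<open>effective_eq\<close>.\<close>

class enc =
  fixes tr :: "'a \<Rightarrow> tree"
  assumes tr_eq_iff: "tr x = tr y \<longleftrightarrow> x = y"

instantiation tree :: enc
begin
definition "tr_tree = (\<lambda>t :: tree. t)"
instance by standard (simp add: tr_tree_def)
end

instantiation unit :: enc
begin
definition "tr_unit = (\<lambda>_ :: unit. Leaf)"
instance by standard simp
end

text \<open>With \<open>False\<close> as \<open>Leaf\<close> and \<open>True\<close> as a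
  \<open>Node\<close>, an effective predicate serves directly as the test of \<open>Cond\<close> and
  \<open>Loop\<close>.\<close>

instantiation bool :: enc
begin
definition "tr_bool = (\<lambda>b. if b then Node Leaf Leaf else Leaf)"
instance by standard (simp add: tr_bool_def)
end

instantiation nat :: enc
begin
primrec tr_nat :: "nat \<Rightarrow> tree" where
  "tr_nat 0 = Leaf"
| "tr_nat (Suc n) = Node Leaf (tr_nat n)"
instance
proof
  show "tr m = tr n \<longleftrightarrow> m = n" for m n :: nat
    by (induction m arbitrary: n) (case_tac n; simp)+
qed
end

instantiation prod :: (enc, enc) enc
begin
definition "tr_prod = (\<lambda>(x :: 'a, y :: 'b). Node (tr x) (tr y))"
instance by standard (auto simp: tr_prod_def tr_eq_iff)
end

instantiation option :: (enc) enc
begin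
fun tr_option :: "'a option \<Rightarrow> tree" where
  "tr_option None = Leaf"
| "tr_option (Some x) = Node Leaf (tr x)"
instance
proof
  show "tr x = tr y \<longleftrightarrow> x = y" for x y :: "'a option"
    by (cases x; cases y) (auto simp: tr_eq_iff)
qed
end

instantiation list :: (enc) enc
begin
primrec tr_list :: "'a list \<Rightarrow> tree" where
  "tr_list [] = Leaf"
| "tr_list (x # xs) = Node (tr x) (tr_list xs)"
instance
proof
  show "tr xs = tr ys \<longleftrightarrow> xs = ys" for xs ys :: "'a list"
    by (induction xs arbitrary: ys) (case_tac ys; simp add: tr_eq_iff)+
qed
end

instantiation move :: enc
begin
fun tr_move :: "move \<Rightarrow> tree" where
  "tr_move Stay = Leaf"
| "tr_move Go_Left = Node Leaf Leaf"
| "tr_move Go_Right = Node Leaf (Node Leaf Leaf)"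
instance
proof
  show "tr x = tr y \<longleftrightarrow> x = y" for x y :: move
    by (cases x; cases y) auto
qed
end

text \<open>Outside \<open>S\<close> the program may diverge. This is meant for unbounded search,
  which halts only where a solution exists, and in the end for the learner.\<close>

definition effective_on :: "'a::enc set \<Rightarrow> ('a \<Rightarrow> 'b::enc) \<Rightarrow> bool" where
  "effective_on S f \<longleftrightarrow> (\<exists>c. \<forall>x\<in>S. ev c (tr x) (tr (f x)))"

abbreviation effective :: "('a::enc \<Rightarrow> 'b::enc) \<Rightarrow> bool" where
  "effective \<equiv> effective_on UNIV"

lemma effective_onI: "(\<And>x. x \<in> S \<Longrightarrow> ev c (tr x) (tr (f x))) \<Longrightarrow> effective_on S f"
  unfolding effective_on_def by blast

lemma effective_onE:
  assumes "effective_on S f"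
  obtains c where "\<And>x. x \<in> S \<Longrightarrow> ev c (tr x) (tr (f x))"
  using assms unfolding effective_on_def by blast

section \<open>Closure under composition, constructors and case distinction\<close>

lemma effective_on_comp:
  assumes "effective f" "effective_on S g"
  shows "effective_on S (\<lambda>x. f (g x))"
proof -
  obtain F G where "\<And>y. ev F (tr y) (tr (f y))" "\<And>x. x \<in> S \<Longrightarrow> ev G (tr x) (tr (g x))"
    using assms by (metis effective_onE UNIV_I)
  then show ?thesis by (intro effective_onI[where c = "Comp F G"] ev_Comp) auto
qed

lemmas effective_comp = effective_on_comp[of _ UNIV]

lemma effective_id: "effective (\<lambda>x. x)"
  by (rule effective_onI) (rule ev_Ident)

primrec quote :: "tree \<Rightarrow> tprog" where
  "quote Leaf = Empty"
| "quote (Node a b) = Pair (quote a) (quote b)"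

lemma ev_quote: "ev (quote t) x t"
  by (induction t) (auto intro: ev_Empty ev_Pair)

lemma effective_const: "effective (\<lambda>x. a)"
  by (rule effective_onI) (rule ev_quote)

lemma effective_by_node:
  assumes "effective f" "effective g" "\<And>x. tr (h x) = Node (tr (f x)) (tr (g x))"
  shows "effective h"
proof -
  obtain F G where "\<And>x. ev F (tr x) (tr (f x))" "\<And>x. ev G (tr x) (tr (g x))"
    using assms(1,2) by (metis effective_onE UNIV_I)
  then show ?thesis
    by (intro effective_onI[where c = "Pair F G"]) (simp add: assms(3) ev_Pair)
qed

lemma effective_Pair: "effective f \<Longrightarrow> effective g \<Longrightarrow> effective (\<lambda>x. (f x, g x))"
  by (erule (1) effective_by_node) (simp add: tr_prod_def)

lemma effective_fst: "effective f \<Longrightarrow> effective (\<lambda>x. fst (f x))"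
proof -
  have "ev Lft (tr x) (tr (fst x))" for x :: "'b \<times> 'c"
    using ev_Lft[of "tr x"] by (simp add: tr_prod_def split_beta)
  from effective_comp[OF effective_onI[of UNIV, OF this]]
  show "effective f \<Longrightarrow> effective (\<lambda>x. fst (f x))" .
qed

lemma effective_snd: "effective f \<Longrightarrow> effective (\<lambda>x. snd (f x))"
proof -
  have "ev Rgt (tr x) (tr (snd x))" for x :: "'b \<times> 'c"
    using ev_Rgt[of "tr x"] by (simp add: tr_prod_def split_beta)
  from effective_comp[OF effective_onI[of UNIV, OF this]]
  show "effective f \<Longrightarrow> effective (\<lambda>x. snd (f x))" .
qed

lemma effective_comp2:
  assumes "effective (\<lambda>p. f (fst p) (snd p))" "effective g" "effective h"
  shows "effective (\<lambda>x. f (g x) (h x))"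
  using effective_comp[OF assms(1) effective_Pair[OF assms(2,3)]] by simp

lemma effective_comp3:
  assumes "effective (\<lambda>p. f (fst p) (fst (snd p)) (snd (snd p)))"
    "effective g" "effective h" "effective k"
  shows "effective (\<lambda>x. f (g x) (h x) (k x))"
  using effective_comp[OF assms(1) effective_Pair[OF assms(2) effective_Pair[OF assms(3,4)]]] by simp

lemma effective_If:
  assumes "effective p" "effective f" "effective g"
  shows "effective (\<lambda>x. if p x then f x else g x)"
proof -
  obtain P F G where *: "\<And>x. ev P (tr x) (tr (p x))" "\<And>x. ev F (tr x) (tr (f x))"
    "\<And>x. ev G (tr x) (tr (g x))"
    using assms by (metis effective_onE UNIV_I)
  show ?thesis
  proof (rule effective_onI)
    fix x show "ev (Cond P F G) (tr x) (tr (if p x then f x else g x))"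
      using *(1)[of x] ev_Cond_Node[OF _ *(2)] ev_Cond_Leaf[OF _ *(3)]
      by (cases "p x") (simp_all add: tr_bool_def)
  qed
qed

lemma effective_not: "effective p \<Longrightarrow> effective (\<lambda>x. \<not> p x)"
proof -
  have "(\<lambda>x. if p x then False else True) = (\<lambda>x. \<not> p x)" by auto
  then show "effective p \<Longrightarrow> effective (\<lambda>x. \<not> p x)"
    using effective_If[of p "\<lambda>_. False" "\<lambda>_. True"] by (simp only: effective_const)
qed

lemma effective_conj: "effective p \<Longrightarrow> effective q \<Longrightarrow> effective (\<lambda>x. p x \<and> q x)"
proof -
  have "(\<lambda>x. if p x then q x else False) = (\<lambda>x. p x \<and> q x)" by auto
  then show "effective p \<Longrightarrow> effective q \<Longrightarrow> effective (\<lambda>x. p x \<and> q x)"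
    using effective_If[of p q "\<lambda>_. False"] by (simp only: effective_const)
qed

lemma effective_disj: "effective p \<Longrightarrow> effective q \<Longrightarrow> effective (\<lambda>x. p x \<or> q x)"
  using effective_not[OF effective_conj[OF effective_not effective_not]] by simp

lemma effective_Cons: "effective f \<Longrightarrow> effective g \<Longrightarrow> effective (\<lambda>x. f x # g x)"
  by (erule (1) effective_by_node) simp

lemma effective_Suc: "effective f \<Longrightarrow> effective (\<lambda>x. Suc (f x))"
  by (rule effective_by_node[OF effective_const[of "()"]]) (simp_all add: tr_unit_def)

lemma effective_Some: "effective f \<Longrightarrow> effective (\<lambda>x. Some (f x))"
  by (rule effective_by_node[OF effective_const[of "()"]]) (simp_all add: tr_unit_def)

text \<open>Common core of the four case rules. \<open>S\<close> selects what the node branch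
  receives: the whole node for lists and trees, where it is already the encoding of the pair of
  components, and its right child for numbers and options, whose left child is a dummy.\<close>

lemma effective_case:
  assumes "effective l" "effective n" "effective c" and S: "\<And>t. ev S t (s t)"
    and leaf: "\<And>x. tr (l x) = Leaf \<Longrightarrow> h x = n x"
    and node: "\<And>x a b. tr (l x) = Node a b \<Longrightarrow> \<exists>y. tr y = s (Node a b) \<and> h x = c (x, y)"
  shows "effective h"
proof -
  obtain L N C where *: "\<And>x. ev L (tr x) (tr (l x))" "\<And>x. ev N (tr x) (tr (n x))"
    "\<And>p. ev C (tr p) (tr (c p))"
    using assms(1-3) by (metis effective_onE UNIV_I)
  show ?thesis
  proof (rule effective_onI)
    fix x show "ev (Cond L (Comp C (Pair Ident (Comp S L))) N) (tr x) (tr (h x))"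
    proof (cases "tr (l x)")
      case Leaf
      then show ?thesis using *(1,2)[of x] leaf by (simp add: ev_Cond_Leaf)
    next
      case (Node a b)
      then obtain y where y: "tr y = s (tr (l x))" "h x = c (x, y)"
        using node by metis
      have "ev (Comp S L) (tr x) (tr y)"
        unfolding y(1) by (rule ev_Comp[OF *(1) S])
      from ev_Pair[OF ev_Ident this] have "ev (Pair Ident (Comp S L)) (tr x) (tr (x, y))"
        by (simp add: tr_prod_def)
      from ev_Comp[OF this *(3)] have "ev (Comp C (Pair Ident (Comp S L))) (tr x) (tr (h x))"
        by (simp add: y(2))
      with ev_Cond_Node *(1)[of x] Node show ?thesis by metis
    qed
  qed
qed

lemma effective_case_list:
  assumes "effective l" "effective n"
    and "effective (\<lambda>p. c (fst p) (fst (snd p)) (snd (snd p)))"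
  shows "effective (\<lambda>x. case l x of [] \<Rightarrow> n x | h # t \<Rightarrow> c x h t)"
proof (rule effective_case[OF assms ev_Ident])
  fix x a b assume "tr (l x) = Node a b"
  then obtain y t where "l x = y # t" "tr y = a" "tr t = b" by (cases "l x") auto
  then show "\<exists>p. tr p = Node a b \<and> (case l x of [] \<Rightarrow> n x | h # t \<Rightarrow> c x h t) =
      c (fst (x, p)) (fst (snd (x, p))) (snd (snd (x, p)))"
    by (intro exI[of _ "(y, t)"]) (simp add: tr_prod_def)
qed (auto split: list.splits)

lemma effective_case_tree:
  assumes "effective l" "effective n"
    and "effective (\<lambda>p. c (fst p) (fst (snd p)) (snd (snd p)))"
  shows "effective (\<lambda>x. case l x of Leaf \<Rightarrow> n x | Node a b \<Rightarrow> c x a b)"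
proof (rule effective_case[OF assms ev_Ident])
  fix x a b assume "tr (l x) = Node a b"
  then show "\<exists>p. tr p = Node a b \<and> (case l x of Leaf \<Rightarrow> n x | Node a b \<Rightarrow> c x a b) =
      c (fst (x, p)) (fst (snd (x, p))) (snd (snd (x, p)))"
    by (intro exI[of _ "(a, b)"]) (simp add: tr_prod_def tr_tree_def)
qed (auto simp: tr_tree_def split: tree.splits)

lemma effective_case_nat:
  assumes "effective l" "effective n" "effective (\<lambda>p. c (fst p) (snd p))"
  shows "effective (\<lambda>x. case l x of 0 \<Rightarrow> n x | Suc k \<Rightarrow> c x k)"
proof (rule effective_case[OF assms ev_Rgt])
  fix x a b assume "tr (l x) = Node a b"
  then show "\<exists>k. tr k = right (Node a b) \<and> (case l x of 0 \<Rightarrow> n x | Suc k \<Rightarrow> c x k) =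
      c (fst (x, k)) (snd (x, k))"
    by (cases "l x") auto
qed (auto split: nat.splits)

lemma effective_case_option:
  assumes "effective l" "effective n" "effective (\<lambda>p. c (fst p) (snd p))"
  shows "effective (\<lambda>x. case l x of None \<Rightarrow> n x | Some k \<Rightarrow> c x k)"
proof (rule effective_case[OF assms ev_Rgt])
  fix x a b assume "tr (l x) = Node a b"
  then show "\<exists>k. tr k = right (Node a b) \<and> (case l x of None \<Rightarrow> n x | Some k \<Rightarrow> c x k) =
      c (fst (x, k)) (snd (x, k))"
    by (cases "l x") auto
qed (auto split: option.splits)

lemma effective_tl: "effective f \<Longrightarrow> effective (\<lambda>x. tl (f x))"
proof -
  have "ev Rgt (tr xs) (tr (tl xs))" for xs :: "'b list"
    using ev_Rgt[of "tr xs"] by (cases xs) auto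
  from effective_comp[OF effective_onI[of UNIV, OF this]]
  show "effective f \<Longrightarrow> effective (\<lambda>x. tl (f x))" .
qed

named_theorems effective_intros

lemmas [effective_intros] = effective_const effective_id effective_Pair effective_fst effective_snd
  effective_If effective_not effective_conj effective_disj effective_Cons effective_Suc
  effective_Some effective_case_list effective_case_tree effective_case_nat
  effective_case_option effective_tl

section \<open>Terminating loops and unbounded search\<close>

text \<open>\<open>I\<close> is the function to be computed, given as an invariant: rounds of the
  loop preserve it while \<open>m\<close> decreases, and at the exit \<open>out\<close> reads it
  off. No recursion has to be compiled.\<close>

lemma effective_tail_recursion:
  fixes m :: "'a::enc \<Rightarrow> nat"
  assumes "effective p" "effective f" "effective out"
    and dec: "\<And>s. p s \<Longrightarrow> m (f s) < m s" and inv: "\<And>s. p s \<Longrightarrow> I (f s) = I s"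
    and exit: "\<And>s. \<not> p s \<Longrightarrow> I s = out s"
  shows "effective I"
proof -
  obtain P F G where *: "\<And>x. ev P (tr x) (tr (p x))" "\<And>x. ev F (tr x) (tr (f x))"
    "\<And>x. ev G (tr x) (tr (out x))"
    using assms(1-3) by (metis effective_onE UNIV_I)
  have "\<exists>t. ev (Loop P F) (tr s) (tr t) \<and> I s = out t" for s
  proof (induction "m s" arbitrary: s rule: less_induct)
    case less
    show ?case
    proof (cases "p s")
      case True
      obtain t where t: "ev (Loop P F) (tr (f s)) (tr t)" "I (f s) = out t"
        using less[OF dec[OF True]] by blast
      have "ev P (tr s) (Node Leaf Leaf)"
        using *(1)[of s] True by (simp add: tr_bool_def)
      from ev_Loop_Node[OF this *(2) t(1)] show ?thesis
        using inv[OF True] t(2) by auto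
    next
      case False
      have "ev P (tr s) Leaf"
        using *(1)[of s] False by (simp add: tr_bool_def)
      from ev_Loop_Leaf[OF this] show ?thesis
        using exit[OF False] by blast
    qed
  qed
  then have "ev (Comp G (Loop P F)) (tr s) (tr (I s))" for s
    using *(3) by (metis ev_Comp)
  then show ?thesis by (rule effective_onI)
qed

lemma effective_on_Least:
  fixes P :: "'a::enc \<Rightarrow> nat \<Rightarrow> bool"
  assumes "effective (\<lambda>p. P (fst p) (snd p))"
  shows "effective_on {x. \<exists>n. P x n} (\<lambda>x. LEAST n. P x n)"
proof -
  have "effective (\<lambda>p. \<not> P (fst p) (snd p))"
    by (intro effective_intros assms)
  then obtain Q where Q: "\<And>p. ev Q (tr p) (tr (\<not> P (fst p) (snd p)))"
    unfolding effective_on_def by blast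
  have "effective (\<lambda>p :: 'a \<times> nat. (fst p, Suc (snd p)))"
    by (intro effective_intros)
  then obtain F where F: "\<And>p :: 'a \<times> nat. ev F (tr p) (tr (fst p, Suc (snd p)))"
    unfolding effective_on_def by blast
  have "effective (\<lambda>x :: 'a. (x, 0 :: nat))"
    by (intro effective_intros)
  then obtain S where S: "\<And>x :: 'a. ev S (tr x) (tr (x, 0 :: nat))"
    unfolding effective_on_def by blast
  have "effective (\<lambda>p :: 'a \<times> nat. snd p)"
    by (intro effective_intros)
  then obtain G where G: "\<And>p :: 'a \<times> nat. ev G (tr p) (tr (snd p))"
    unfolding effective_on_def by blast
  \<comment> \<open>Induction on the distance \<open>k\<close> to the least solution
    \<open>n\<close>; the derivation is built from the last round backwards, as
    \<open>ev_Loop_Node\<close> requires.\<close>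
  have *: "ev (Loop Q F) (tr (x, n - k)) (tr (x, n))"
    if n: "P x n" "\<And>i. i < n \<Longrightarrow> \<not> P x i" and "k \<le> n" for x n k
    using \<open>k \<le> n\<close>
  proof (induction k)
    case 0
    then show ?case using Q[of "(x, n)"] n(1) by (simp add: tr_bool_def ev_Loop_Leaf)
  next
    case (Suc k)
    have 1: "ev F (tr (x, n - Suc k)) (tr (x, n - k))"
      using F[of "(x, n - Suc k)"] Suc.prems by (simp add: Suc_diff_Suc)
    have "ev Q (tr (x, n - Suc k)) (Node Leaf Leaf)"
      using Q[of "(x, n - Suc k)"] n(2)[of "n - Suc k"] Suc.prems by (simp add: tr_bool_def)
    from ev_Loop_Node[OF this 1] show ?case using Suc by simp
  qed
  have L: "ev (Loop Q F) (tr (x, 0 :: nat)) (tr (x, LEAST n. P x n))" if "\<exists>n. P x n" for x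
    using *[OF LeastI_ex[OF that] not_less_Least[where P = "P x"] order_refl] by simp
  show ?thesis
  proof (rule effective_onI)
    fix x assume "x \<in> {x. \<exists>n. P x n}"
    then have "\<exists>n. P x n" by simp
    from ev_Comp[OF ev_Comp[OF S L[OF this]] G]
    show "ev (Comp G (Comp (Loop Q F) S)) (tr x) (tr (LEAST n. P x n))" by simp
  qed
qed

lemma effective_Least:
  fixes P :: "'a::enc \<Rightarrow> nat \<Rightarrow> bool"
  assumes "effective (\<lambda>p. P (fst p) (snd p))" "\<And>x. \<exists>n. P x n"
  shows "effective (\<lambda>x. LEAST n. P x n)"
  using effective_on_Least[OF assms(1)] assms(2) by (simp add: UNIV_def[symmetric])

section \<open>Lists, arithmetic, equality and lookup\<close>

text \<open>Functions are not data, so the closure \<open>F x\<close> cannot be passed around.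
  Instead its parameter \<open>x\<close> travels as the first component of the loop state, next to
  the accumulator and the remaining list.\<close>

lemma effective_foldl [effective_intros]:
  assumes F: "effective (\<lambda>p. F (fst p) (fst (snd p)) (snd (snd p)))"
    and "effective s" "effective l"
  shows "effective (\<lambda>x. foldl (F x) (s x) (l x))"
proof -
  have "effective (\<lambda>q. foldl (F (fst q)) (fst (snd q)) (snd (snd q)))"
  proof (rule effective_tail_recursion[where p = "\<lambda>q. case snd (snd q) of [] \<Rightarrow> False | h # t \<Rightarrow> True"
        and f = "\<lambda>q. case snd (snd q) of [] \<Rightarrow> q | h # t \<Rightarrow> (fst q, F (fst q) (fst (snd q)) h, t)"
        and out = "\<lambda>q. fst (snd q)" and m = "\<lambda>q. length (snd (snd q))"])
    show "effective (\<lambda>q :: 'a \<times> 'b \<times> 'c list. case snd (snd q) of [] \<Rightarrow> q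
        | h # t \<Rightarrow> (fst q, F (fst q) (fst (snd q)) h, t))"
      by (intro effective_intros effective_comp3[OF F])
  qed (intro effective_intros | force split: list.splits)+
  from effective_comp3[OF this effective_id assms(2,3)] show ?thesis .
qed

lemma effective_funpow [effective_intros]:
  fixes F :: "'a::enc \<Rightarrow> 'b::enc \<Rightarrow> 'b"
  assumes F: "effective (\<lambda>p. F (fst p) (snd p))" and "effective n" "effective s"
  shows "effective (\<lambda>x. (F x ^^ n x) (s x))"
proof -
  have "effective (\<lambda>q. (F (fst q) ^^ fst (snd q)) (snd (snd q)))"
  proof (rule effective_tail_recursion[where p = "\<lambda>q. case fst (snd q) of 0 \<Rightarrow> False | Suc k \<Rightarrow> True"
        and f = "\<lambda>q. case fst (snd q) of 0 \<Rightarrow> q | Suc k \<Rightarrow> (fst q, k, F (fst q) (snd (snd q)))"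
        and out = "\<lambda>q. snd (snd q)" and m = "\<lambda>q. fst (snd q)"])
    show "effective (\<lambda>q :: 'a \<times> nat \<times> 'b. case fst (snd q) of 0 \<Rightarrow> q
        | Suc k \<Rightarrow> (fst q, k, F (fst q) (snd (snd q))))"
      by (intro effective_intros effective_comp2[OF F])
  qed (intro effective_intros | force simp: funpow_swap1 split: nat.splits)+
  from effective_comp3[OF this effective_id assms(2,3)] show ?thesis .
qed

lemma effective_rev [effective_intros]:
  assumes "effective f" shows "effective (\<lambda>x. rev (f x))"
proof -
  have "effective (\<lambda>x. foldl (\<lambda>xs y. y # xs) [] (f x))"
    by (intro effective_intros assms)
  then show ?thesis by (simp add: rev_conv_fold foldl_conv_fold)
qed

lemma effective_foldr [effective_intros]:
  assumes F: "effective (\<lambda>p. F (fst p) (fst (snd p)) (snd (snd p)))"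
    and "effective l" "effective s"
  shows "effective (\<lambda>x. foldr (F x) (l x) (s x))"
  unfolding foldr_conv_foldl by (intro effective_intros effective_comp3[OF F] assms(2,3))

lemma effective_append [effective_intros]:
  assumes "effective f" "effective g" shows "effective (\<lambda>x. f x @ g x)"
proof -
  have "effective (\<lambda>x. foldr (#) (f x) (g x))"
    by (intro effective_intros assms)
  moreover have "foldr (#) xs ys = xs @ ys" for xs ys :: "'b list"
    by (induction xs) auto
  ultimately show ?thesis by simp
qed

lemma effective_map [effective_intros]:
  assumes F: "effective (\<lambda>p. F (fst p) (snd p))" and "effective l"
  shows "effective (\<lambda>x. map (F x) (l x))"
proof -
  have "effective (\<lambda>x. foldr (\<lambda>y ys. F x y # ys) (l x) [])"
    by (intro effective_intros assms effective_comp2[OF F])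
  moreover have "foldr (\<lambda>y ys. F x y # ys) ys [] = map (F x) ys" for x ys
    by (induction ys) auto
  ultimately show ?thesis by simp
qed

lemma effective_list_all [effective_intros]:
  assumes P: "effective (\<lambda>p. P (fst p) (snd p))" and "effective l"
  shows "effective (\<lambda>x. \<forall>y\<in>set (l x). P x y)"
proof -
  have "effective (\<lambda>x. foldr (\<lambda>y b. P x y \<and> b) (l x) True)"
    by (intro effective_intros assms effective_comp2[OF P])
  moreover have "foldr (\<lambda>y b. P x y \<and> b) ys True \<longleftrightarrow> (\<forall>y\<in>set ys. P x y)" for x ys
    by (induction ys) auto
  ultimately show ?thesis by simp
qed

lemma effective_list_ex [effective_intros]:
  assumes P: "effective (\<lambda>p. P (fst p) (snd p))" and "effective l"
  shows "effective (\<lambda>x. \<exists>y\<in>set (l x). P x y)"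
proof -
  have "effective (\<lambda>x. \<not> (\<forall>y\<in>set (l x). \<not> P x y))"
    by (intro effective_intros assms effective_comp2[OF P])
  then show ?thesis by simp
qed

lemma effective_concat [effective_intros]:
  assumes "effective f" shows "effective (\<lambda>x. concat (f x))"
  unfolding concat_conv_foldr by (intro effective_intros assms)

lemma effective_zip [effective_intros]:
  assumes "effective f" "effective g" shows "effective (\<lambda>x. zip (f x) (g x))"
proof -
  let ?F = "\<lambda>s x. case snd s of [] \<Rightarrow> s | y # ys \<Rightarrow> (fst s @ [(x, y)], ys)"
  have "effective (\<lambda>x. fst (foldl ?F ([], g x) (f x)))"
    by (intro effective_intros assms)
  moreover have "fst (foldl ?F (zs, ys) xs) = zs @ zip xs ys"
    for xs :: "'b list" and ys :: "'c list" and zs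
  proof (induction xs arbitrary: ys zs)
    case (Cons x xs)
    have "fst (foldl ?F (zs, []) xs) = zs" for xs :: "'b list" and zs by (induction xs) auto
    then show ?case using Cons by (cases ys) auto
  qed simp
  ultimately show ?thesis by simp
qed

lemma effective_replicate [effective_intros]:
  assumes "effective n" "effective f" shows "effective (\<lambda>x. replicate (n x) (f x))"
proof -
  have "effective (\<lambda>x. ((#) (f x) ^^ n x) [])"
    by (intro effective_intros assms effective_comp[OF assms(2)])
  moreover have "((#) a ^^ k) [] = replicate k a" for a :: 'b and k
    by (induction k) auto
  ultimately show ?thesis by simp
qed

lemma effective_length [effective_intros]:
  assumes "effective f" shows "effective (\<lambda>x. length (f x))"
proof -
  have "effective (\<lambda>x. foldr (\<lambda>_. Suc) (f x) 0)"
    by (intro effective_intros assms)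
  moreover have "foldr (\<lambda>_. Suc) xs 0 = length xs" for xs :: "'b list"
    by (induction xs) auto
  ultimately show ?thesis by simp
qed

lemma effective_plus [effective_intros]:
  fixes f :: "'a::enc \<Rightarrow> nat"
  assumes "effective f" "effective g" shows "effective (\<lambda>x. f x + g x)"
proof -
  have "effective (\<lambda>x. (Suc ^^ f x) (g x))"
    by (intro effective_intros assms)
  then show ?thesis by (simp add: Suc_funpow)
qed

lemma effective_pred [effective_intros]:
  assumes "effective f" shows "effective (\<lambda>x. f x - Suc 0)"
proof -
  have "effective (\<lambda>x. case f x of 0 \<Rightarrow> 0 | Suc k \<Rightarrow> k)"
    by (intro effective_intros assms)
  moreover have "(case n of 0 \<Rightarrow> 0 | Suc k \<Rightarrow> k) = n - Suc 0" for n by (cases n) auto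
  ultimately show ?thesis by simp
qed

lemma effective_less [effective_intros]:
  fixes f :: "'a::enc \<Rightarrow> nat"
  assumes "effective f" "effective g" shows "effective (\<lambda>x. f x < g x)"
proof -
  have "effective (\<lambda>x. case ((\<lambda>n. n - Suc 0) ^^ f x) (g x) of 0 \<Rightarrow> False | Suc k \<Rightarrow> True)"
    by (intro effective_intros assms)
  moreover have "((\<lambda>n. n - Suc 0) ^^ m) n = n - m" for m n
    by (induction m) auto
  moreover have "(case n - m of 0 \<Rightarrow> False | Suc k \<Rightarrow> True) \<longleftrightarrow> m < n" for m n
    by (auto split: nat.splits)
  ultimately show ?thesis by simp
qed

lemma effective_upt [effective_intros]:
  assumes "effective f" shows "effective (\<lambda>x. [0..<f x])"
proof -
  have "effective (\<lambda>x. snd (((\<lambda>s. (Suc (fst s), snd s @ [fst s])) ^^ f x) (0, [])))"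
    by (intro effective_intros assms)
  moreover have "((\<lambda>s. (Suc (fst s), snd s @ [fst s])) ^^ n) (0, []) = (n, [0..<n])" for n
    by (induction n) auto
  ultimately show ?thesis by simp
qed

text \<open>The double recursion becomes a loop over an agenda of pairs still to be compared. A
  mismatch lowers the flag and empties the agenda.\<close>

lemma effective_eq_tree: "effective (\<lambda>p :: tree \<times> tree. fst p = snd p)"
proof -
  let ?f = "\<lambda>q. case snd q of [] \<Rightarrow> q | h # t \<Rightarrow>
     (case fst h of
        Leaf \<Rightarrow> (case snd h of Leaf \<Rightarrow> (fst q, t) | Node c d \<Rightarrow> (False, []))
      | Node a b \<Rightarrow> (case snd h of Leaf \<Rightarrow> (False, []) | Node c d \<Rightarrow> (fst q, (a, c) # (b, d) # t)))"
  have "effective (\<lambda>q :: bool \<times> (tree \<times> tree) list. fst q \<and> (\<forall>h\<in>set (snd q). fst h = snd h))"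
  \<comment> \<open>\<open>size\<close> counts inner nodes, so \<open>Suc (2 * size t)\<close> is
    the number of all vertices of \<open>t\<close>, leaves included. Replacing a pair of nodes by
    the two pairs of children removes one vertex from the total.\<close>
  proof (rule effective_tail_recursion[where p = "\<lambda>q. case snd q of [] \<Rightarrow> False | h # t \<Rightarrow> True"
        and f = ?f and out = fst and m = "\<lambda>q. \<Sum>h\<leftarrow>snd q. Suc (2 * size (fst h))"])
    show "effective ?f" by (intro effective_intros)
    fix s :: "bool \<times> (tree \<times> tree) list"
    assume "case snd s of [] \<Rightarrow> False | h # t \<Rightarrow> True"
    then obtain b u v t where s: "s = (b, (u, v) # t)"
      by (cases s; cases "snd s") auto
    show "(\<Sum>h\<leftarrow>snd (?f s). Suc (2 * size (fst h))) < (\<Sum>h\<leftarrow>snd s. Suc (2 * size (fst h)))"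
      unfolding s by (cases u; cases v) auto
    show "(fst (?f s) \<and> (\<forall>h\<in>set (snd (?f s)). fst h = snd h)) =
        (fst s \<and> (\<forall>h\<in>set (snd s). fst h = snd h))"
      unfolding s by (cases u; cases v) auto
  next
    fix s :: "bool \<times> (tree \<times> tree) list"
    assume "\<not> (case snd s of [] \<Rightarrow> False | h # t \<Rightarrow> True)"
    then show "(fst s \<and> (\<forall>h\<in>set (snd s). fst h = snd h)) = fst s"
      by (cases "snd s") auto
  qed (intro effective_intros)+
  from effective_comp[OF this, of "\<lambda>p :: tree \<times> tree. (True, [p])"]
  show ?thesis by (simp add: effective_intros)
qed

lemma effective_eq [effective_intros]:
  fixes f :: "'a::enc \<Rightarrow> 'b::enc"
  assumes "effective f" "effective g" shows "effective (\<lambda>x. f x = g x)"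
proof -
  obtain c where c: "\<And>p :: tree \<times> tree. ev c (tr p) (tr (fst p = snd p))"
    using effective_eq_tree unfolding effective_on_def by blast
  have "ev c (tr p) (tr (fst p = snd p))" for p :: "'b \<times> 'b"
    using c[of "(tr (fst p), tr (snd p))"]
    by (cases p) (simp add: tr_prod_def tr_tree_def tr_eq_iff)
  then have "effective (\<lambda>p :: 'b \<times> 'b. fst p = snd p)" by (rule effective_onI)
  from effective_comp2[OF this assms] show ?thesis .
qed

lemma effective_map_of [effective_intros]:
  assumes "effective f" "effective g" shows "effective (\<lambda>x. map_of (f x) (g x))"
proof -
  have "effective (\<lambda>x. foldr (\<lambda>p r. if g x = fst p then Some (snd p) else r) (f x) None)"
    by (intro effective_intros assms effective_comp[OF assms(2)])
  moreover have "foldr (\<lambda>p r. if k = fst p then Some (snd p) else r) ps None = map_of ps k"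
    for k :: 'b and ps :: "('b \<times> 'c) list"
    by (induction ps) auto
  ultimately show ?thesis by simp
qed


subsection \<open>Simulating a Turing machine given by its description\<close>

text \<open>A tape is represented by the cells left of the head, nearest first, and those from the head on.\<close>

type_synonym ltape = "sym list \<times> sym list"

definition hd_sym :: "sym list \<Rightarrow> sym" where
  "hd_sym xs = (case xs of [] \<Rightarrow> None | s # _ \<Rightarrow> s)"

text \<open>Cells beyond the stored list are blank, so finite lists describe the infinite tape. In
  \<open>tape_at\<close> the left list starts at cell -1, hence the index
  \<open>- i - 1\<close>.\<close>

definition nth_sym :: "sym list \<Rightarrow> nat \<Rightarrow> sym" where
  "nth_sym xs n = (if n < length xs then xs ! n else None)"

lemma hd_sym_simps [simp]: "hd_sym [] = None" "hd_sym (x # xs) = x"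
  by (auto simp: hd_sym_def)

definition tape_at :: "ltape \<Rightarrow> tape" where
  "tape_at t = (\<lambda>i. if 0 \<le> i then nth_sym (snd t) (nat i) else nth_sym (fst t) (nat (- i - 1)))"

definition lact :: "sym \<times> move \<Rightarrow> ltape \<Rightarrow> ltape" where
  "lact a t =
     (if snd a = Stay then (fst t, fst a # tl (snd t))
      else if snd a = Go_Left then (tl (fst t), hd_sym (fst t) # fst a # tl (snd t))
      else (fst a # fst t, tl (snd t)))"

lemma nth_sym_simps [simp]:
  "nth_sym (x # xs) n = (case n of 0 \<Rightarrow> x | Suc k \<Rightarrow> nth_sym xs k)"
  "nth_sym (tl xs) n = nth_sym xs (Suc n)" "nth_sym [] n = None" "nth_sym xs 0 = hd_sym xs"
  by (cases xs; auto simp: nth_sym_def hd_sym_def split: nat.splits)+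

lemma tape_at_lact: "tape_at (lact a t) = act a (tape_at t)"
proof
  fix i
  obtain s m where a: "a = (s, m)" by (cases a)
  show "tape_at (lact a t) i = act a (tape_at t) i"
  proof (cases m)
    case Go_Left
    have "nat (- i) = Suc (nat (- i - 1))" if "i < 0" using that by simp
    moreover have "nat i = Suc (nat (i - 1))" if "i > 0" using that by simp
    ultimately show ?thesis
      by (cases i "0 :: int" rule: linorder_cases) (auto simp: a Go_Left lact_def tape_at_def split: nat.splits)
  next
    case Stay
    then show ?thesis
      by (auto simp: a lact_def tape_at_def split: nat.splits)
  next
    case Go_Right
    have "nat (i + 1) = Suc (nat i)" if "i \<ge> 0" using that by simp
    moreover have "nat (- i - 1) = Suc (nat (- 2 - i))" if "i < - 1" using that by simp
    ultimately show ?thesis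
      by (cases i "- 1 :: int" rule: linorder_cases) (auto simp: a Go_Right lact_def tape_at_def split: nat.splits)
  qed
qed

type_synonym lconfig = "nat \<times> ltape list"

definition config_at :: "lconfig \<Rightarrow> config" where
  "config_at c = (fst c, map tape_at (snd c))"

definition lstep :: "rule list \<Rightarrow> lconfig \<Rightarrow> lconfig option" where
  "lstep rs c = (case map_of rs (fst c, map (\<lambda>t. hd_sym (snd t)) (snd c)) of
      None \<Rightarrow> None
    | Some r \<Rightarrow> Some (fst r, map (\<lambda>p. lact (fst p) (snd p)) (zip (snd r) (snd c))))"

lemma step_config_at: "step (TM k rs) (config_at c) = map_option config_at (lstep rs c)"
proof -
  have "tape_at t 0 = hd_sym (snd t)" for t
    by (simp add: tape_at_def)
  then show ?thesis
    by (simp add: config_at_def lstep_def comp_def tape_at_lact zip_map2 split_beta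
        split: option.split)
qed

text \<open>A halted configuration is repeated, so the \<open>n\<close>-th iterate exists for every
  \<open>n\<close> and iterating past the halt does no harm.\<close>

definition lnext :: "rule list \<Rightarrow> lconfig \<Rightarrow> lconfig" where
  "lnext rs c = (case lstep rs c of None \<Rightarrow> c | Some c' \<Rightarrow> c')"

definition linitial :: "nat \<Rightarrow> word \<Rightarrow> lconfig" where
  "linitial k w = (0, ([], map Some w) # replicate (k - Suc 0) ([], []))"

lemma config_at_linitial: "config_at (linitial k w) = initial (TM k rs) w"
proof -
  have "tape_at ([], map Some w) = tape_of w" for w
    by (rule ext) (auto simp: tape_at_def tape_of_def nth_sym_def)
  from this[of w] this[of "[]"] show ?thesis
    by (simp add: config_at_def linitial_def initial_def)
qed

definition read_word :: "sym list \<Rightarrow> word" where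
  "read_word xs = foldr (\<lambda>s w. case s of None \<Rightarrow> [] | Some b \<Rightarrow> b # w) xs []"

lemma shows_word_read_word: "shows_word (tape_at (l, xs)) (read_word xs)"
proof -
  have "(\<forall>i<length (read_word xs). nth_sym xs i = Some (read_word xs ! i)) \<and>
        nth_sym xs (length (read_word xs)) = None"
    by (induction xs) (auto simp: read_word_def nth_Cons hd_sym_def split: option.splits nat.splits)
  then show ?thesis by (simp add: shows_word_def tape_at_def)
qed

definition loutput :: "lconfig \<Rightarrow> word" where
  "loutput c = (case snd c of [] \<Rightarrow> [] | t # _ \<Rightarrow> read_word (snd t))"

lemma lnext_fixed: "lstep rs c = None \<Longrightarrow> (lnext rs ^^ n) c = c"
  by (induction n) (auto simp: lnext_def)

text \<open>\<open>zip\<close> would silently lose tapes if a rule had too few actions;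
  well-formedness excludes this. The first tape thus survives, and \<open>loutput\<close> reads a
  real tape and not its default.\<close>

lemma length_lnext:
  assumes "well_formed (TM k rs)" "length (snd c) = k"
  shows "length (snd ((lnext rs ^^ n) c)) = k"
proof (induction n)
  case (Suc n)
  have "length (snd (lnext rs c)) = k" if "length (snd c) = k" for c
  proof (cases "lstep rs c")
    case (Some c')
    then obtain r where r: "map_of rs (fst c, map (\<lambda>t. hd_sym (snd t)) (snd c)) = Some r"
      "snd c' = map (\<lambda>p. lact (fst p) (snd p)) (zip (snd r) (snd c))"
      by (auto simp: lstep_def split: option.splits)
    then have "length (snd r) = k"
      using assms(1) map_of_SomeD[OF r(1)] by (cases r) (fastforce simp: well_formed_def)
    then show ?thesis using Some r(2) that by (simp add: lnext_def)
  qed (simp add: lnext_def that)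
  then show ?case using Suc by simp
qed (simp add: assms)

lemma yields_simulation:
  assumes wf: "well_formed (TM k rs)" and y: "yields (TM k rs) x y"
  shows "\<exists>n. lstep rs ((lnext rs ^^ n) (linitial k x)) = None"
    and "loutput ((lnext rs ^^ (LEAST n. lstep rs ((lnext rs ^^ n) (linitial k x)) = None)) (linitial k x)) = y"
proof -
  let ?c = "\<lambda>n. (lnext rs ^^ n) (linitial k x)"
  obtain d where d: "(\<lambda>c c'. step (TM k rs) c = Some c')\<^sup>*\<^sup>* (config_at (linitial k x)) d"
    "step (TM k rs) d = None" "shows_word (hd (snd d)) y"
    using y unfolding yields_def config_at_linitial[of k x rs] by (metis snd_conv)
  have "\<exists>n. d = config_at (?c n)" using d(1)
  proof (induction rule: rtranclp_induct)
    case base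
    have "config_at (linitial k x) = config_at (?c 0)" by simp
    then show ?case by blast
  next
    case (step d e)
    then obtain n c' where "lstep rs (?c n) = Some c'" "e = config_at c'"
      by (auto simp: step_config_at)
    then have "e = config_at (?c (Suc n))" by (simp add: lnext_def)
    then show ?case by blast
  qed
  then obtain n where n: "d = config_at (?c n)" by blast
  then have halt: "lstep rs (?c n) = None"
    using d(2) by (simp add: step_config_at)
  then show "\<exists>n. lstep rs (?c n) = None" by blast
  define m where "m = (LEAST n. lstep rs (?c n) = None)"
  have m: "lstep rs (?c m) = None" "m \<le> n"
    using halt unfolding m_def by (rule LeastI, rule Least_le)
  \<comment> \<open>The step \<open>n\<close> found along the given run need not be the least
    halting step \<open>m\<close>, but the configuration is constant from \<open>m\<close>
    on.\<close>
  have "?c n = (lnext rs ^^ (n - m)) (?c m)"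
    using m(2) by (simp flip: funpow_add comp_apply[of "lnext rs ^^ (n - m)"])
  then have eq: "?c n = ?c m" by (simp add: lnext_fixed[OF m(1)])
  have k: "0 < k" using wf by (simp add: well_formed_def)
  then have "length (snd (?c m)) = k"
    using length_lnext[OF wf] by (simp add: linitial_def)
  with k obtain l r ts where "snd (?c m) = (l, r) # ts"
    by (cases "snd (?c m)") auto
  then have "shows_word (hd (snd d)) (loutput (?c m))"
    using shows_word_read_word by (simp add: n eq config_at_def loutput_def)
  then show "loutput (?c m) = y" using d(3) shows_word_unique by blast
qed

lemma effective_hd_sym [effective_intros]: "effective f \<Longrightarrow> effective (\<lambda>x. hd_sym (f x))"
  unfolding hd_sym_def by (intro effective_intros)

lemma effective_lact: "effective (\<lambda>p. lact (fst p) (snd p))"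
  unfolding lact_def by (intro effective_intros)

lemma effective_lstep: "effective (\<lambda>p. lstep (fst p) (snd p))"
  unfolding lstep_def by (intro effective_intros effective_comp2[OF effective_lact])

lemma effective_lnext: "effective (\<lambda>p. lnext (fst p) (snd p))"
  unfolding lnext_def by (intro effective_intros effective_comp2[OF effective_lstep])

lemma effective_linitial: "effective (\<lambda>p. linitial (fst p) (snd p))"
  unfolding linitial_def by (intro effective_intros)

lemma effective_loutput: "effective loutput"
proof -
  have "effective (\<lambda>c. loutput c)"
    unfolding loutput_def read_word_def by (intro effective_intros)
  then show ?thesis .
qed

text \<open>The universal machine: \<open>k\<close> and \<open>rs\<close> may depend on the
  argument. Constant ones give back computable functions; those obtained from the output of
  \<open>R\<close> evaluate its programs. Halting for every \<open>x\<close> makes the search for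
  the halting step total.\<close>

theorem effective_yields:
  assumes eff: "effective k" "effective rs" "effective inp"
    and M: "\<And>x. well_formed (TM (k x) (rs x))" "\<And>x. yields (TM (k x) (rs x)) (inp x) (out x)"
  shows "effective out"
proof -
  define c where "c = (\<lambda>x n. (lnext (rs x) ^^ n) (linitial (k x) (inp x)))"
  have c: "effective (\<lambda>p. c (fst p) (snd p))"
    unfolding c_def
    by (intro effective_intros effective_comp2[OF effective_lnext] effective_comp2[OF effective_linitial]
        eff[THEN effective_comp])
  have "effective (\<lambda>x. LEAST n. lstep (rs x) (c x n) = None)"
    using yields_simulation(1)[OF M] unfolding c_def[symmetric]
    by (intro effective_Least effective_intros effective_comp2[OF effective_lstep] c
        eff[THEN effective_comp]) (auto simp: c_def)
  then have "effective (\<lambda>x. loutput (c x (LEAST n. lstep (rs x) (c x n) = None)))"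
    by (intro effective_comp[OF effective_loutput] effective_comp2[OF c] effective_id)
  moreover have "loutput (c x (LEAST n. lstep (rs x) (c x n) = None)) = out x" for x
    using yields_simulation(2)[OF M] by (simp add: c_def)
  ultimately show ?thesis by simp
qed


subsection \<open>Parsing and printing codes\<close>

text \<open>Returning the unread rest \<open>u\<close> is what lets parsers be chained for pairs and
  lists.\<close>

definition parseable :: "('a::enc \<Rightarrow> word) \<Rightarrow> bool" where
  "parseable e \<longleftrightarrow> (\<exists>p. effective p \<and> (\<forall>x u. p (e x @ u) = (x, u)))"

lemma parseableI: "effective p \<Longrightarrow> (\<And>x u. p (e x @ u) = (x, u)) \<Longrightarrow> parseable e"
  unfolding parseable_def by blast

lemma parseable_bool: "parseable (\<lambda>b. [b])"
proof (rule parseableI)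
  show "effective (\<lambda>w. case w of [] \<Rightarrow> (False, []) | b # u \<Rightarrow> (b, u))"
    by (intro effective_intros)
qed simp

lemma parseable_unit: "parseable (\<lambda>_ :: unit. [])"
proof (rule parseableI)
  show "effective (\<lambda>w :: word. ((), w))"
    by (intro effective_intros)
qed simp

lemma parseable_pair:
  assumes "parseable d" "parseable e"
  shows "parseable (code_pair d e)"
proof -
  obtain p q where p: "effective p" "\<And>x u. p (d x @ u) = (x, u)"
    and q: "effective q" "\<And>x u. q (e x @ u) = (x, u)"
    using assms unfolding parseable_def by metis
  show ?thesis
  proof (rule parseableI)
    show "effective (\<lambda>w. ((fst (p w), fst (q (snd (p w)))), snd (q (snd (p w)))))"
      by (intro effective_intros effective_comp[OF p(1)] effective_comp[OF q(1)])
  qed (auto simp: code_pair_def p(2) q(2))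
qed

lemma parseable_list:
  assumes "parseable e"
  shows "parseable (code_list e)"
proof -
  obtain p where p: "effective p" "\<And>x u. p (e x @ u) = (x, u)"
    using assms unfolding parseable_def by metis
  define F where "F = (\<lambda>s. case snd s of [] \<Rightarrow> s
    | b # w \<Rightarrow> if b then (fst s @ [fst (p w)], snd (p w)) else s)"
  have stop: "(F ^^ n) (ys, False # u) = (ys, False # u)" for n ys u
    by (induction n) (auto simp: F_def)
  have run: "(F ^^ n) (ys, code_list e xs @ u) = (ys @ xs, False # u)" if "length xs \<le> n" for n xs ys u
    using that
  proof (induction xs arbitrary: ys n)
    case Nil
    then show ?case using stop by (simp add: code_list_def)
  next
    case (Cons x xs)
    then obtain m where "n = Suc m" "length xs \<le> m" by (cases n) auto
    moreover have "F (ys, code_list e (x # xs) @ u) = (ys @ [x], code_list e xs @ u)"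
      by (simp add: F_def code_list_def p(2))
    ultimately show ?case using Cons.IH by (simp add: funpow_swap1 del: funpow.simps(2)) (simp add: funpow_swap1)
  qed
  \<comment> \<open>Each entry contributes at least its leading \<open>True\<close>, so the length
    of the input is a sufficient number of rounds; surplus rounds idle at the final
    \<open>False\<close>, by \<open>stop\<close>.\<close>
  have "length xs \<le> length (code_list e xs @ u)" for xs u
    by (induction xs) (auto simp: code_list_def)
  note run = run[OF this]
  show ?thesis
  proof (rule parseableI)
    show "effective (\<lambda>w. (fst ((F ^^ length w) ([], w)), tl (snd ((F ^^ length w) ([], w)))))"
      unfolding F_def by (intro effective_intros effective_comp[OF p(1)])
  qed (simp add: run del: length_append)
qed

text \<open>The unary code of \<open>n\<close> is the list code of \<open>n\<close> units with empty
  entry codes, so the list parser does the work.\<close>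

lemma parseable_nat: "parseable code_nat"
proof -
  obtain p where p: "effective p" "\<And>xs u. p (code_list (\<lambda>_ :: unit. []) xs @ u) = (xs, u)"
    using parseable_list[OF parseable_unit] unfolding parseable_def by metis
  have "code_nat n = code_list (\<lambda>_ :: unit. []) (replicate n ())" for n
    by (induction n) (auto simp: code_nat_def code_list_def)
  note * = p(2)[of "replicate n ()" for n, folded this]
  show ?thesis
  proof (rule parseableI)
    show "effective (\<lambda>w. (length (fst (p w)), snd (p w)))"
      by (intro effective_intros effective_comp[OF p(1)])
  qed (simp add: *)
qed

lemma parseable_sym: "parseable code_sym"
proof (rule parseableI)
  let ?p = "\<lambda>w. case w of [] \<Rightarrow> (None, []) | b # u \<Rightarrow>
    if b then (case u of [] \<Rightarrow> (None, []) | c # v \<Rightarrow> (Some c, v)) else (None, u)"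
  show "effective ?p" by (intro effective_intros)
  show "?p (code_sym x @ u) = (x, u)" for x u by (cases x) auto
qed

lemma parseable_move: "parseable code_move"
proof (rule parseableI)
  let ?p = "\<lambda>w. case w of [] \<Rightarrow> (Stay, []) | b # u \<Rightarrow>
    if b then (case u of [] \<Rightarrow> (Stay, []) | c # v \<Rightarrow> (if c then Go_Right else Go_Left, v)) else (Stay, u)"
  show "effective ?p" by (intro effective_intros)
  show "?p (code_move x @ u) = (x, u)" for x u by (cases x) auto
qed

lemma parseable_word: "parseable code_word"
  unfolding code_word_def by (intro parseable_list parseable_bool)

lemma parseable_rule: "parseable code_rule"
  unfolding code_rule_def
  by (intro parseable_pair parseable_nat parseable_list parseable_sym parseable_move)

text \<open>Weaker than \<open>parseable\<close>, because a raw word given as it is, by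
  \<open>\<lambda>w. w\<close>, carries no mark of its end and yet needs no decoding.\<close>

definition decodable :: "('a::enc \<Rightarrow> word) \<Rightarrow> bool" where
  "decodable e \<longleftrightarrow> (\<exists>p. effective p \<and> (\<forall>x. p (e x) = x))"

lemma decodable_parseable:
  assumes "parseable e" shows "decodable e"
proof -
  obtain p where p: "effective p" "\<And>x u. p (e x @ u) = (x, u)"
    using assms unfolding parseable_def by metis
  have "effective (\<lambda>w. fst (p w))" by (intro effective_intros effective_comp[OF p(1)] effective_id)
  moreover have "fst (p (e x)) = x" for x using p(2)[of x "[]"] by simp
  ultimately show ?thesis unfolding decodable_def by blast
qed

lemma decodable_word: "decodable (\<lambda>w. w)"
  unfolding decodable_def using effective_id by blast

lemma effective_of_decodable:
  assumes "decodable e" "effective (\<lambda>x. e (f x))"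
  shows "effective f"
proof -
  obtain p where "effective p" "\<And>x. p (e x) = x"
    using assms(1) unfolding decodable_def by blast
  then show ?thesis using effective_comp[OF _ assms(2)] by fastforce
qed

lemma effective_code_nat: "effective (\<lambda>n. code_nat n)"
  unfolding code_nat_def by (intro effective_intros)

lemma effective_code_word: "effective (\<lambda>w. code_word w)"
  unfolding code_word_def code_list_def by (intro effective_intros)

lemma effective_code_pair:
  assumes "effective d" "effective e" shows "effective (code_pair d e)"
proof -
  have "effective (\<lambda>p. d (fst p) @ e (snd p))"
    by (intro effective_intros effective_comp[OF assms(1)] effective_comp[OF assms(2)])
  then show ?thesis by (simp add: code_pair_def case_prod_unfold)
qed


subsection \<open>Effective functions and computable functions\<close>

lemma yields_of_effective_on:
  fixes f :: "word \<Rightarrow> word"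
  assumes "effective_on S f"
  obtains M where "well_formed M" "\<And>w. w \<in> S \<Longrightarrow> yields M w (f w)"
proof -
  have tr: "tr w = tree_of_word w" for w :: word
    by (induction w) (auto simp: tr_bool_def)
  obtain c where c: "\<And>w. w \<in> S \<Longrightarrow> ev c (tr w) (tr (f w))"
    using assms unfolding effective_on_def by blast
  obtain M where "well_formed M"
    "\<And>v w. ev c (tree_of_word v) (tree_of_word w) \<Longrightarrow> yields M v w"
    using yields_of_ev[of c] by metis
  then show thesis using c that unfolding tr by blast
qed

lemma computable_of_effective:
  assumes "decodable d" "effective e" "effective f"
  shows "computable d e f"
proof -
  obtain p where p: "effective p" "\<And>x. p (d x) = x"
    using assms(1) unfolding decodable_def by blast
  have "effective (\<lambda>w. e (f (p w)))"
    by (intro assms(2)[THEN effective_comp] assms(3)[THEN effective_comp] p(1))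
  then obtain M where "well_formed M" "\<And>w. yields M w (e (f (p w)))"
    using yields_of_effective_on by (metis UNIV_I)
  then have "well_formed M" "\<And>x. yields M (d x) (e (f x))"
    using p(2) by metis+
  then show ?thesis unfolding computable_def by blast
qed

lemma effective_of_computable:
  assumes "computable d e f" "effective d" "decodable e"
  shows "effective f"
proof -
  obtain M where M: "well_formed M" "\<And>x. yields M (d x) (e (f x))"
    using assms(1) unfolding computable_def by blast
  have "effective (\<lambda>x. e (f x))"
    using effective_yields[of "\<lambda>_. tapes M" "\<lambda>_. rules M" d] M assms(2)
    by (simp add: effective_const)
  with assms(3) show ?thesis by (rule effective_of_decodable)
qed


subsection \<open>Deciding equivalence, bounding the length complexity and learning\<close>

text \<open>Two simulations in succession: running \<open>R\<close> on \<open>p\<close> and parsing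
  its output yields tapes and rules as data, and these become the machine simulated on the second
  argument. One program thus serves all \<open>p\<close>.\<close>

lemma effective_denotation:
  assumes R: "encoding_system R"
  shows "effective (\<lambda>p. denotation R (fst p) (snd p))"
proof -
  \<comment> \<open>\<open>M\<close> is merely chosen; that its parts depend effectively on
    \<open>p\<close> follows because \<open>description (M p)\<close> is what \<open>R\<close>
    prints.\<close>
  obtain M where wf: "\<And>p. well_formed (M p)" and desc: "\<And>p. yields R p (description (M p))"
    and total: "\<And>p x. \<exists>b. yields (M p) x [b]"
    using R unfolding encoding_system_def by metis
  have y: "yields (M p) x [denotation R p x]" for p x
    using denotation_iff[OF desc, of p x "denotation R p x"] total by simp
  have wfR: "well_formed R"
    using R by (simp add: encoding_system_def)
  have "effective (\<lambda>p. description (M p))"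
    by (rule effective_yields[of "\<lambda>_. tapes R" "\<lambda>_. rules R" "\<lambda>p. p"])
      (simp_all add: wfR desc effective_const effective_id)
  moreover have "description (M p) = code_pair code_nat (code_list code_rule) (tapes (M p), rules (M p))" for p
    by (simp add: description_def code_pair_def)
  moreover have "decodable (code_pair code_nat (code_list code_rule))"
    by (intro decodable_parseable parseable_pair parseable_nat parseable_list parseable_rule)
  ultimately have *: "effective (\<lambda>p. (tapes (M p), rules (M p)))"
    using effective_of_decodable[of "code_pair code_nat (code_list code_rule)" "\<lambda>p. (tapes (M p), rules (M p))"]
    by simp
  have "effective (\<lambda>q. [denotation R (fst q) (snd q)])"
  proof (rule effective_yields)
    show "effective (\<lambda>q :: word \<times> word. tapes (M (fst q)))"
      using effective_fst[OF effective_comp[OF * effective_fst[OF effective_id]]] by simp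
    show "effective (\<lambda>q :: word \<times> word. rules (M (fst q)))"
      using effective_snd[OF effective_comp[OF * effective_fst[OF effective_id]]] by simp
    show "effective (\<lambda>q :: word \<times> word. snd q)" by (intro effective_intros)
  qed (simp_all add: wf y)
  with decodable_parseable[OF parseable_bool] show ?thesis by (rule effective_of_decodable)
qed

text \<open>The order of the words is immaterial in the searches, so this iterative form, which
  suits \<open>effective_funpow\<close>, replaces \<open>words_upto\<close>.\<close>

definition short_words :: "nat \<Rightarrow> word list" where
  "short_words n = ((\<lambda>ws. [] # map ((#) True) ws @ map ((#) False) ws) ^^ n) [[]]"

lemma set_short_words: "set (short_words n) = {x. length x \<le> n}"
proof (induction n)
  case (Suc n)
  have "short_words (Suc n) = [] # map ((#) True) (short_words n) @ map ((#) False) (short_words n)"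
    by (simp add: short_words_def)
  then have "set (short_words (Suc n)) = insert [] (\<Union>b. (#) b ` {x. length x \<le> n})"
    using Suc by (auto simp: UNIV_bool)
  also have "\<dots> = {x. length x \<le> Suc n}"
    by (auto simp: image_iff Suc_le_length_iff) (metis Suc_le_mono length_Cons neq_Nil_conv)
  finally show ?case .
qed (simp add: short_words_def)

lemma effective_short_words [effective_intros]:
  assumes "effective f" shows "effective (\<lambda>x. short_words (f x))"
  unfolding short_words_def by (intro effective_intros assms)

section \<open>Classes of bounded complexity and separating lengths\<close>

lemma complexity_le: "complexity R C (denotation R p) \<le> C p"
  unfolding complexity_def by (rule Least_le) blast

lemma complexity_attained:
  assumes "f \<in> representable R"
  obtains p where "denotation R p = f" "C p = complexity R C f"
proof -
  have "\<exists>c p. denotation R p = f \<and> C p = c"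
    using assms unfolding representable_def by blast
  from LeastI_ex[OF this] show thesis
    using that unfolding complexity_def by blast
qed

text \<open>The minimum defining the complexity is attained, so a class of functions becomes the
  image of a set of words, which is finite under the assumption on \<open>C\<close>.\<close>

lemma representable_upto_eq: "representable_upto R C c = denotation R ` {p. C p \<le> c}"
proof
  show "representable_upto R C c \<subseteq> denotation R ` {p. C p \<le> c}"
  proof
    fix f assume "f \<in> representable_upto R C c"
    then have f: "f \<in> representable R" "complexity R C f \<le> c"
      by (auto simp: representable_upto_def)
    obtain p where "denotation R p = f" "C p = complexity R C f"
      by (rule complexity_attained[OF f(1)])
    with f(2) show "f \<in> denotation R ` {p. C p \<le> c}" by auto
  qed
  show "denotation R ` {p. C p \<le> c} \<subseteq> representable_upto R C c"
    using complexity_le[of R C] by (auto simp: representable_upto_def representable_def intro: order_trans)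
qed

text \<open>\<open>LEAST\<close> carries information only if some bound exists. For finite
  \<open>F\<close> one takes a separating word for each pair of distinct functions and the maximal
  length of these words.\<close>

lemma eq_of_length_complexity:
  assumes "finite F" "f \<in> F" "g \<in> F"
    and eq: "\<And>x. length x \<le> length_complexity F \<Longrightarrow> f x = g x"
  shows "f = g"
proof -
  have "\<exists>n. \<forall>f\<in>F. \<forall>g\<in>F. f \<noteq> g \<longrightarrow> (\<exists>x. length x \<le> n \<and> f x \<noteq> g x)"
  proof -
    have "\<forall>p\<in>F \<times> F. fst p \<noteq> snd p \<longrightarrow> (\<exists>x. fst p x \<noteq> snd p x)"
      by auto
    then obtain w where w: "\<forall>p\<in>F \<times> F. fst p \<noteq> snd p \<longrightarrow> fst p (w p) \<noteq> snd p (w p)"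
      by metis
    let ?n = "Max ((\<lambda>p. length (w p)) ` (F \<times> F))"
    have "length (w (f, g)) \<le> ?n" if "f \<in> F" "g \<in> F" for f g
      using assms(1) that by (intro Max_ge) auto
    with w show ?thesis
      by (intro exI[of _ ?n]) (metis SigmaI fst_conv snd_conv)
  qed
  from LeastI_ex[OF this] show ?thesis
    using assms unfolding length_complexity_def[symmetric] by blast
qed

lemma length_complexity_le:
  assumes "\<And>f g. f \<in> F \<Longrightarrow> g \<in> F \<Longrightarrow> (\<And>x. length x \<le> n \<Longrightarrow> f x = g x) \<Longrightarrow> f = g"
  shows "length_complexity F \<le> n"
  unfolding length_complexity_def by (rule Least_le) (use assms in blast)

section \<open>The four implications for a system with an effective enumeration\<close>

locale enumerated_system =
  fixes R :: tm and C :: "word \<Rightarrow> nat" and E :: "nat \<Rightarrow> word"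
  assumes R: "encoding_system R"
    and effective_C: "effective C" and effective_E: "effective E"
    and range_E: "range E = UNIV" and mono_E: "\<And>i j. i \<le> j \<Longrightarrow> C (E i) \<le> C (E j)"
    and finite_C: "\<And>c. finite {p. C p \<le> c}"
begin

lemmas effective_system [effective_intros] = effective_comp[OF effective_C] effective_comp[OF effective_E]
  effective_comp2[OF effective_denotation[OF R]]

lemma finite_upto: "finite (representable_upto R C c)"
  unfolding representable_upto_eq using finite_C by blast

lemma denotation_eq_upto:
  assumes "C p \<le> c" "C q \<le> c" "length_complexity (representable_upto R C c) \<le> n"
    and "\<And>x. length x \<le> n \<Longrightarrow> denotation R p x = denotation R q x"
  shows "denotation R p = denotation R q"
  by (rule eq_of_length_complexity[OF finite_upto[of c]]) (use assms in \<open>auto simp: representable_upto_eq\<close>)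

text \<open>The words of complexity at most \<open>c\<close> are among those listed before the first one exceeding \<open>c\<close>.\<close>

lemma bounded_of_decidable:
  assumes "equivalence_decidable R"
  shows "computably_bounded (\<lambda>c. length_complexity (representable_upto R C c))"
proof -
  have "effective (\<lambda>(p, q). denotation R p = denotation R q)"
    using assms unfolding equivalence_decidable_def
    by (rule effective_of_computable)
      (intro effective_code_pair effective_code_word decodable_parseable parseable_bool)+
  then have dec: "effective (\<lambda>p. denotation R (fst p) = denotation R (snd p))"
    by (simp add: case_prod_unfold)
  \<comment> \<open>Only finitely many words have complexity at most \<open>c\<close>, while there
    are infinitely many words, so the enumeration does exceed \<open>c\<close>; by monotonicity it
    never returns.\<close>
  define m where "m = (\<lambda>c. LEAST m. c < C (E m))"
  have ex: "\<exists>m. c < C (E m)" for c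
  proof -
    have "{p. C p \<le> c} \<noteq> UNIV"
      using finite_C[of c] infinite_UNIV_listI by metis
    then have "\<exists>p. \<not> C p \<le> c" by blast
    then obtain p where "c < C p" by (auto simp: not_le)
    moreover obtain m where "p = E m" using range_E by (metis rangeE UNIV_I)
    ultimately show ?thesis by blast
  qed
  have m: "effective (\<lambda>c. m c)"
    unfolding m_def by (intro effective_Least effective_intros ex)
  have enum: "\<exists>i<m c. p = E i" if "C p \<le> c" for p c
  proof -
    obtain i where i: "p = E i" using range_E by (metis rangeE UNIV_I)
    have "c < C (E (m c))" unfolding m_def by (rule LeastI_ex[OF ex])
    then have "\<not> m c \<le> i" using mono_E[of "m c" i] that i by auto
    then show ?thesis using i by (auto simp: not_le)
  qed
  \<comment> \<open>The first disjunct is where the decider enters: equivalent pairs, which no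
    length separates, are exempt, so the search for \<open>n\<close> terminates.\<close>
  define P where "P = (\<lambda>c n. \<forall>i\<in>set [0..<m c]. \<forall>j\<in>set [0..<m c].
    denotation R (E i) = denotation R (E j) \<or>
    (\<exists>x\<in>set (short_words n). denotation R (E i) x \<noteq> denotation R (E j) x))"
  have exP: "\<exists>n. P c n" for c
  proof -
    let ?F = "(\<lambda>i. denotation R (E i)) ` {..<m c}"
    have "P c (length_complexity ?F)"
      unfolding P_def using eq_of_length_complexity[of ?F] by (fastforce simp: set_short_words)
    then show ?thesis by blast
  qed
  have agree: "denotation R (E i) = denotation R (E j)"
    if "P c n" "i < m c" "j < m c" "\<And>x. length x \<le> n \<Longrightarrow> denotation R (E i) x = denotation R (E j) x"
    for c n i j
    using that unfolding P_def by (fastforce simp: set_short_words)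
  have "effective (\<lambda>c. LEAST n. P c n)"
    unfolding P_def
    by (rule effective_Least)
      (intro effective_intros effective_comp[OF m] effective_comp2[OF dec], use exP in \<open>simp add: P_def\<close>)
  then have "computable code_nat code_nat (\<lambda>c. LEAST n. P c n)"
    by (intro computable_of_effective decodable_parseable parseable_nat effective_code_nat)
  moreover have "length_complexity (representable_upto R C c) \<le> (LEAST n. P c n)" for c
  proof (rule length_complexity_le)
    fix f g assume fg: "f \<in> representable_upto R C c" "g \<in> representable_upto R C c"
      and eq: "\<And>x. length x \<le> (LEAST n. P c n) \<Longrightarrow> f x = g x"
    obtain i j where "i < m c" "j < m c" "f = denotation R (E i)" "g = denotation R (E j)"
      using fg enum unfolding representable_upto_eq by blast
    with eq show "f = g"
      using agree[OF LeastI_ex[OF exP]] by blast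
  qed
  ultimately show ?thesis unfolding computably_bounded_def by blast
qed

text \<open>Any common bound on the two complexities puts both functions into one class; the sum is
  such a bound. Inside that class, agreement on the finitely many words up to the bounding length is
  equality.\<close>

lemma decidable_of_bounded:
  assumes "computably_bounded (\<lambda>c. length_complexity (representable_upto R C c))"
  shows "equivalence_decidable R"
proof -
  obtain h where h: "computable code_nat code_nat h"
    "\<And>c. length_complexity (representable_upto R C c) \<le> h c"
    using assms unfolding computably_bounded_def by blast
  have eff_h: "effective h"
    using h(1) by (rule effective_of_computable) (intro effective_code_nat decodable_parseable parseable_nat)+
  let ?d = "\<lambda>p. \<forall>x\<in>set (short_words (h (C (fst p) + C (snd p)))). denotation R (fst p) x = denotation R (snd p) x"
  have "effective ?d"
    by (intro effective_intros effective_comp[OF eff_h])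
  moreover have "?d p \<longleftrightarrow> denotation R (fst p) = denotation R (snd p)" for p
    using denotation_eq_upto[of "fst p" "C (fst p) + C (snd p)" "snd p", OF _ _ h(2)]
    by (auto simp: set_short_words)
  ultimately have "effective (\<lambda>(p, q). denotation R p = denotation R q)"
    by (simp add: case_prod_unfold)
  then show ?thesis
    unfolding equivalence_decidable_def
    by (intro computable_of_effective decodable_parseable parseable_pair parseable_word effective_Cons
        effective_id effective_const)
qed

lemma learning_of_bounded:
  assumes "computably_bounded (\<lambda>c. length_complexity (representable_upto R C c))"
  shows "nonasymptotic_length_generalization R C"
proof -
  obtain h where h: "computable code_nat code_nat h"
    "\<And>c. length_complexity (representable_upto R C c) \<le> h c"
    using assms unfolding computably_bounded_def by blast
  have "decodable (code_list (code_pair code_word (\<lambda>b. [b])))"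
    by (intro decodable_parseable parseable_pair parseable_word parseable_list parseable_bool)
  then obtain data where data: "effective data" "\<And>N f. data (training_word N f) = training_list N f"
    unfolding decodable_def training_word_def by metis
  define P where "P = (\<lambda>w i. \<forall>d\<in>set (data w). denotation R (E i) (fst d) = snd d)"
  have P: "P (training_word N f) i \<longleftrightarrow> (\<forall>x. length x \<le> N \<longrightarrow> denotation R (E i) x = f x)" for N f i
    by (auto simp: P_def data(2) set_training_list training_set_def)
  \<comment> \<open>On a word with which no program is consistent the search never ends, so the
    learner is a partial function.\<close>
  have "effective_on {w. \<exists>i. P w i} (\<lambda>w. E (LEAST i. P w i))"
    unfolding P_def
    by (intro effective_on_comp[OF effective_E] effective_on_Least effective_intros effective_comp[OF data(1)])
  then obtain A where A: "well_formed A" "\<And>w. \<exists>i. P w i \<Longrightarrow> yields A w (E (LEAST i. P w i))"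
    by (rule yields_of_effective_on) simp
  have consistent: "\<exists>i. C (E i) = complexity R C f \<and> denotation R (E i) = f" if "f \<in> representable R" for f
    using complexity_attained[OF that, of C] range_E by (metis rangeE UNIV_I)
  have "\<exists>p. yields A (training_word N f) p \<and> denotation R p = f"
    if f: "f \<in> representable R" and N: "h (complexity R C f) \<le> N" for f N
  proof -
    let ?i = "LEAST i. P (training_word N f) i"
    obtain j where j: "C (E j) = complexity R C f" "denotation R (E j) = f"
      using consistent[OF f] by blast
    have Pj: "P (training_word N f) j" by (simp add: P j(2))
    then have Pi: "P (training_word N f) ?i" by (rule LeastI)
    \<comment> \<open>The order of the enumeration is used here: the first consistent index is at
      most \<open>j\<close>, so the guess is no more complex than \<open>f\<close> and
      \<open>h\<close> at that complexity separates the two unless they are equal.\<close>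
    have "C (E ?i) \<le> complexity R C f"
      unfolding j(1)[symmetric] by (intro mono_E Least_le Pj)
    then have "denotation R (E ?i) = denotation R (E j)"
    proof (rule denotation_eq_upto)
      show "C (E j) \<le> complexity R C f" by (simp add: j(1))
      show "length_complexity (representable_upto R C (complexity R C f)) \<le> N"
        using h(2) N by (rule order_trans)
      show "denotation R (E ?i) x = denotation R (E j) x" if "length x \<le> N" for x
        using Pi that by (simp add: P j(2))
    qed
    then show ?thesis using A(2) Pj j(2) by blast
  qed
  moreover have "learning_algorithm R A"
    unfolding learning_algorithm_def
  proof (intro conjI ballI allI)
    fix f N assume "f \<in> representable R"
    \<comment> \<open>An output is due also below the threshold. A program for \<open>f\<close>
      itself is consistent with its data at every length, so the search always ends.\<close>
    from consistent[OF this] show "\<exists>p. yields A (training_word N f) p"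
      using A(2)[of "training_word N f"] by (auto simp: P)
  qed (rule A(1))
  ultimately show ?thesis
    using h(1) unfolding nonasymptotic_length_generalization_def by blast
qed

lemma bounded_of_learning:
  assumes "nonasymptotic_length_generalization R C"
  shows "computably_bounded (\<lambda>c. length_complexity (representable_upto R C c))"
proof -
  obtain A N where N: "computable code_nat code_nat N"
    and A: "\<And>f n. f \<in> representable R \<Longrightarrow> N (complexity R C f) \<le> n \<Longrightarrow>
      \<exists>p. yields A (training_word n f) p \<and> denotation R p = f"
    using assms unfolding nonasymptotic_length_generalization_def by metis
  have eff_N: "effective N"
    using N by (rule effective_of_computable) (intro effective_code_nat decodable_parseable parseable_nat)+
  \<comment> \<open>Two functions in the class may have different complexities and \<open>N\<close>
    need not be monotone, so \<open>N c\<close> alone would not do; the sum exceeds every threshold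
    \<open>N i\<close> with \<open>i \<le> c\<close>. The learner itself is not run by this program:
    it occurs only in the proof of the bound.\<close>
  let ?h = "\<lambda>c. foldr (\<lambda>i a. N i + a) [0..<Suc c] 0"
  have "effective ?h"
    by (intro effective_intros effective_comp[OF eff_N])
  then have "computable code_nat code_nat ?h"
    by (intro computable_of_effective decodable_parseable parseable_nat effective_code_nat)
  moreover have "length_complexity (representable_upto R C c) \<le> ?h c" for c
  proof (rule length_complexity_le)
    have le: "N i \<le> foldr (\<lambda>i a. N i + a) xs 0" if "i \<in> set xs" for i xs
      using that by (induction xs) auto
    have p: "\<exists>p. yields A (training_word (?h c) f) p \<and> denotation R p = f"
      if "f \<in> representable_upto R C c" for f
      using that by (intro A le) (auto simp: representable_upto_def simp del: upt_Suc)
    fix f g assume fg: "f \<in> representable_upto R C c" "g \<in> representable_upto R C c"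
      and eq: "\<And>x. length x \<le> ?h c \<Longrightarrow> f x = g x"
    have "training_set (?h c) f = training_set (?h c) g"
      unfolding training_set_def using eq by auto
    then have "training_list (?h c) f = training_list (?h c) g"
      by (simp only: training_list_eq_iff)
    then have "training_word (?h c) f = training_word (?h c) g"
      by (simp only: training_word_def)
    then show "f = g" using p[OF fg(1)] p[OF fg(2)] yields_unique by metis
  qed
  ultimately show ?thesis unfolding computably_bounded_def by blast
qed

end

theorem lemma4p5:
  fixes R :: tm and C :: "word \<Rightarrow> nat"
  assumes "encoding_system R" and "assumption_E C"
  shows "(equivalence_decidable R \<longleftrightarrow>
            computably_bounded (\<lambda>c. length_complexity (representable_upto R C c))) \<and>
         (equivalence_decidable R \<longleftrightarrow> nonasymptotic_length_generalization R C)"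
proof -
  obtain E where E: "computable code_nat (\<lambda>p. p) E" "range E = UNIV"
    "\<And>i j. i \<le> j \<Longrightarrow> C (E i) \<le> C (E j)"
    and C: "computable (\<lambda>p. p) code_nat C" "\<And>c. finite {p. C p \<le> c}"
    using assms(2) unfolding assumption_E_def by blast
  have "effective E"
    using E(1) by (rule effective_of_computable) (intro effective_code_nat decodable_word)+
  moreover have "effective C"
    using C(1) by (rule effective_of_computable) (intro effective_id decodable_parseable parseable_nat)+
  ultimately interpret enumerated_system R C E
    using assms(1) E C by unfold_locales auto
  show ?thesis
    using bounded_of_decidable decidable_of_bounded learning_of_bounded bounded_of_learning by blast
qed

end
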